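(* The following assertions are equivalent. (i) $R(\alpha W)=\alpha$ (the constant function) for all $\alpha\ge 0$. (ii) Any $g\in\ell^\infty(X)\cap\mathcal F_\varphi$ with $g\le 0$ and $\varphi^{-1}(\mathcal L g)+Wg=0$ satisfies $g=0$. (iii) Any $g\in\ell^\infty(X)\cap\mathcal F_\varphi$ with $g\le 0$ and $\varphi^{-1}(\mathcal L g)+Wg\ge 0$ satisfies $g=0$. (iv) Any $g\in\ell^\infty(X)\cap\mathcal F_\varphi$ with $\varphi^{-1}(\mathcal L g)+Wg\ge 0$ satisfies $g\ge 0$. (v) Any $f\in\ell^\infty(X)$ with $f\ge 0$ and $-\mathcal L f=\varphi(Wf)$ satisfies $f=0$.
   Context: Let $X \neq \emptyset$ be a countable set, $C(X)$ the real-valued functions on $X$, $C_c(X)$ those of finite support, $\ell^\infty(X)$ the bounded ones. Let $m\colon X \to (0,\infty)$. Let $b$ be a weighted graph over $X$: a symmetric function $b\colon X\times X \to [0,\infty)$ with $b(x,x)=0$ and $\deg(x) := \sum_{y\in X} b(x,y) < \infty$ for all $x \in X$. (In)equalities between functions are pointwise on $X$. Formal Laplacian: $\mathcal F = \{f \in C(X) : \sum_{y} b(x,y)|f(y)| < \infty \text{ for all } x\in X\}$ (which contains $\ell^\infty(X)$), and $\mathcal L f(x) = \frac{1}{m(x)}\sum_{y\in X} b(x,y)(f(x)-f(y))$ for $f \in \mathcal F$. Energy: $\mathcal Q(f) = \frac12\sum_{x,y\in X} b(x,y)(f(x)-f(y))^2 \in [0,\infty]$ for $f\in C(X)$, $\mathcal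 D = \{f : \mathcal Q(f)<\infty\}$, and $\mathcal D_0$ is the set of $f \in \mathcal D$ for which there is a sequence $(f_n)$ in $C_c(X)$ with $f_n \to f$ pointwise and $\mathcal Q(f-f_n)\to 0$. Standing assumptions: $\varphi\colon\mathbb R\to\mathbb R$ is continuous and strictly increasing with $\varphi(0)=0$; $W\colon X\to(0,\infty)$ with $\inf_{x\in X} W(x) > 0$. The inverse $\varphi^{-1}$ is defined on the open interval $\mathrm{ran}\,\varphi$. Let $\mathcal F_\varphi = \{f\in\mathcal F : \mathcal L f(x)\in \mathrm{ran}\,\varphi \text{ for all } x\in X\}$; for $f\in\mathcal F_\varphi$, $\varphi^{-1}(\mathcal L f)+Wf$ denotes the function $x\mapsto \varphi^{-1}(\mathcal L f(x)) + W(x)f(x)$. Dirichlet resolvent: let $\Phi(s)=\int_0^s 2\varphi(t)\,dt$. For $f\in C_c(X)$ let $\kappa_f(u)=\sum_{x\in X}\Phi(f(x)-W(x)u(x))\frac{m(x)}{W(x)} \in [0,\infty]$, $D(\mathcal E_f)=\{u\in\mathcal D_0 : \kappa_f(u)<\infty\}$ and $\mathcal E_f(u)=\mathcal Q(u)+\kappa_f(u)$ for $u\in D(\mathcal E_f)$. The functional $\mathcal E_f$ has a unique minimizer on $D(\mathcal E_f)$, denoted $Rf = R^{\varphi,W}f$. Extended Dirichlet resolvent: for $0\le f\in C(X)$, $Rf = R^{\varphi,W}f\colon X\to[0,\infty]$ is $Rf(x)=\sup\{Rg(x) : g\in C_c(X),\ 0\le g\le f\}$ (for $f \in C_c(X)$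 this agrees with the Dirichlet resolvent). *)

theory Defs
  imports "HOL-Analysis.Analysis"
begin

text \<open>
  The countable nonempty set \<open>X\<close> is the universe of a type \<open>'a\<close> of class \<open>countable\<close>, which may be
  finite or infinite; \<open>C(X)\<close> is the type \<open>'a \<Rightarrow> real\<close>.
\<close>

definition Cc :: "('a \<Rightarrow> real) set" where
  "Cc = {f. finite {x. f x \<noteq> 0}}"

definition linfty :: "('a \<Rightarrow> real) set" where
  "linfty = {f. bounded (range f)}"

definition weighted_graph :: "('a::countable \<Rightarrow> 'a \<Rightarrow> real) \<Rightarrow> bool" where
  "weighted_graph b \<longleftrightarrow>
     (\<forall>x y. 0 \<le> b x y) \<and> (\<forall>x y. b x y = b y x) \<and> (\<forall>x. b x x = 0) \<and>
     (\<forall>x. (\<lambda>y. b x y) summable_on UNIV)"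

definition formal_dom :: "('a::countable \<Rightarrow> 'a \<Rightarrow> real) \<Rightarrow> ('a \<Rightarrow> real) set" where
  "formal_dom b = {f. \<forall>x. (\<lambda>y. b x y * \<bar>f y\<bar>) summable_on UNIV}"

definition Lap ::
  "('a::countable \<Rightarrow> 'a \<Rightarrow> real) \<Rightarrow> ('a \<Rightarrow> real) \<Rightarrow> ('a \<Rightarrow> real) \<Rightarrow> 'a \<Rightarrow> real" where
  "Lap b m f x = 1 / m x * (\<Sum>\<^sub>\<infinity>y. b x y * (f x - f y))"

definition formal_dom_phi ::
  "('a::countable \<Rightarrow> 'a \<Rightarrow> real) \<Rightarrow> ('a \<Rightarrow> real) \<Rightarrow> (real \<Rightarrow> real) \<Rightarrow> ('a \<Rightarrow> real) set" where
  "formal_dom_phi b m \<phi> = {f \<in> formal_dom b. \<forall>x. Lap b m f x \<in> range \<phi>}"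

definition energy :: "('a::countable \<Rightarrow> 'a \<Rightarrow> real) \<Rightarrow> ('a \<Rightarrow> real) \<Rightarrow> ennreal" where
  "energy b f = (\<Sum>\<^sub>\<infinity>(x, y). ennreal (b x y * (f x - f y)\<^sup>2)) / 2"

definition finite_energy :: "('a::countable \<Rightarrow> 'a \<Rightarrow> real) \<Rightarrow> ('a \<Rightarrow> real) set" where
  "finite_energy b = {f. energy b f < \<infinity>}"

definition finite_energy0 :: "('a::countable \<Rightarrow> 'a \<Rightarrow> real) \<Rightarrow> ('a \<Rightarrow> real) set" where
  "finite_energy0 b = {f \<in> finite_energy b. \<exists>F :: nat \<Rightarrow> 'a \<Rightarrow> real.
     (\<forall>n. F n \<in> Cc) \<and> (\<forall>x. (\<lambda>n. F n x) \<longlonglongrightarrow> f x) \<and>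
     (\<lambda>n. energy b (\<lambda>x. f x - F n x)) \<longlonglongrightarrow> 0}"

text \<open>The interval integral is oriented, so \<open>Phi \<phi> s \<ge> 0\<close> also for \<open>s < 0\<close>
  (for increasing \<open>\<phi>\<close> with \<open>\<phi> 0 = 0\<close>), and the coercion to \<open>ennreal\<close> in \<open>kappa\<close> loses nothing.\<close>

definition Phi :: "(real \<Rightarrow> real) \<Rightarrow> real \<Rightarrow> real" where
  "Phi \<phi> s = (LBINT t=ereal 0..ereal s. 2 * \<phi> t)"

definition kappa ::
  "('a::countable \<Rightarrow> real) \<Rightarrow> (real \<Rightarrow> real) \<Rightarrow> ('a \<Rightarrow> real) \<Rightarrow> ('a \<Rightarrow> real) \<Rightarrow> ('a \<Rightarrow> real) \<Rightarrow> ennreal" where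
  "kappa m \<phi> W f u = (\<Sum>\<^sub>\<infinity>x. ennreal (Phi \<phi> (f x - W x * u x) * (m x / W x)))"

definition resolvent_dom ::
  "('a::countable \<Rightarrow> 'a \<Rightarrow> real) \<Rightarrow> ('a \<Rightarrow> real) \<Rightarrow> (real \<Rightarrow> real) \<Rightarrow> ('a \<Rightarrow> real) \<Rightarrow> ('a \<Rightarrow> real)
    \<Rightarrow> ('a \<Rightarrow> real) set" where
  "resolvent_dom b m \<phi> W f = {u \<in> finite_energy0 b. kappa m \<phi> W f u < \<infinity>}"

definition resolvent_energy ::
  "('a::countable \<Rightarrow> 'a \<Rightarrow> real) \<Rightarrow> ('a \<Rightarrow> real) \<Rightarrow> (real \<Rightarrow> real) \<Rightarrow> ('a \<Rightarrow> real) \<Rightarrow> ('a \<Rightarrow> real)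
    \<Rightarrow> ('a \<Rightarrow> real) \<Rightarrow> ennreal" where
  "resolvent_energy b m \<phi> W f u = energy b u + kappa m \<phi> W f u"

text \<open>For \<open>f \<in> Cc\<close>, where the minimizer exists and is unique.\<close>

definition resolvent ::
  "('a::countable \<Rightarrow> 'a \<Rightarrow> real) \<Rightarrow> ('a \<Rightarrow> real) \<Rightarrow> (real \<Rightarrow> real) \<Rightarrow> ('a \<Rightarrow> real) \<Rightarrow> ('a \<Rightarrow> real)
    \<Rightarrow> 'a \<Rightarrow> real" where
  "resolvent b m \<phi> W f = (THE u. u \<in> resolvent_dom b m \<phi> W f \<and>
     (\<forall>v \<in> resolvent_dom b m \<phi> W f.
        resolvent_energy b m \<phi> W f u \<le> resolvent_energy b m \<phi> W f v))"

text \<open>For \<open>f \<ge> 0\<close>. The values lie in \<open>[0, \<infinity>]\<close> since \<open>g = 0\<close>, whose resolvent vanishes, is admissible.\<close>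

definition ext_resolvent ::
  "('a::countable \<Rightarrow> 'a \<Rightarrow> real) \<Rightarrow> ('a \<Rightarrow> real) \<Rightarrow> (real \<Rightarrow> real) \<Rightarrow> ('a \<Rightarrow> real) \<Rightarrow> ('a \<Rightarrow> real)
    \<Rightarrow> 'a \<Rightarrow> ereal" where
  "ext_resolvent b m \<phi> W f x =
     (SUP g \<in> {g \<in> Cc. \<forall>y. 0 \<le> g y \<and> g y \<le> f y}. ereal (resolvent b m \<phi> W g x))"

end

theory Submission
  imports Defs
begin

text \<open>
  On a finite set \<open>K\<close>, the equation \<open>\<L> u = \<phi> (f - W u)\<close> with \<open>u = 0\<close> off \<open>K\<close> has a solution between
  \<open>0\<close> and \<open>a\<close> whenever \<open>0 \<le> f \<le> a W\<close> (Perron), obeys a maximum principle against arbitrary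
  supersolutions, and, by Green's formula and convexity of \<open>\<Phi>\<close>, its solution minimizes \<open>\<E>\<^sub>f\<close> among
  functions supported in \<open>K\<close>. Along an exhaustion these solutions increase to \<open>R f\<close>. Consequently
  \<open>R (\<alpha> W)\<close> lies below every nonnegative supersolution of the equation with \<open>f = \<alpha> W\<close> on all of
  \<open>X\<close> and above a solution \<open>w\<close> with values in \<open>[0, \<alpha>]\<close>.

  Given (ii), \<open>g = w - \<alpha>\<close> must vanish, so \<open>R (\<alpha> W) = \<alpha>\<close>. Given (i), if \<open>g \<ge> - \<alpha>\<close> is as in (iv),
  then \<open>g + \<alpha>\<close> is a nonnegative supersolution and hence at least \<open>R (\<alpha> W) = \<alpha>\<close>. The steps
  (iv) to (iii) to (ii) are immediate, and (ii) and (v) correspond under \<open>f = - g\<close>.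
\<close>

section \<open>Preliminaries: sums in \<open>ennreal\<close>, exhaustions, elementary
  inequalities\<close>

text \<open>The library fact \<open>summable_on_ennreal\<close> has a coercion from \<open>enat\<close> inserted in front of its
  function and does not apply here.\<close>

lemma summable_on_ennreal_valued [simp]: "(f :: 'c \<Rightarrow> ennreal) summable_on A"
  by (rule nonneg_summable_on_complete) simp

lemma infsum_diff_real:
  fixes f g :: "'c \<Rightarrow> real"
  assumes "f summable_on A" "g summable_on A"
  shows "(\<Sum>\<^sub>\<infinity>x\<in>A. f x - g x) = infsum f A - infsum g A"
  using infsum_add[OF assms(1) iffD2[OF summable_on_uminus assms(2)]] by (simp add: infsum_uminus)

text \<open>Fatou's lemma for counting measure: finite partial sums pass to the limit, and along the
  sequence they are dominated by the full sums because the terms are nonnegative.\<close>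

lemma infsum_ennreal_liminf:
  fixes f :: "nat \<Rightarrow> 'c \<Rightarrow> ennreal"
  assumes "\<And>x. x \<in> A \<Longrightarrow> (\<lambda>n. f n x) \<longlonglongrightarrow> g x"
  shows "infsum g A \<le> liminf (\<lambda>n. infsum (f n) A)"
proof (rule infsum_le_finite_sums)
  show "g summable_on A" by simp
  fix F assume F: "finite F" "F \<subseteq> A"
  have "(\<lambda>n. sum (f n) F) \<longlonglongrightarrow> sum g F"
    using F assms by (intro tendsto_sum) auto
  hence "sum g F = liminf (\<lambda>n. sum (f n) F)"
    by (simp add: lim_imp_Liminf)
  also have "\<dots> \<le> liminf (\<lambda>n. infsum (f n) A)"
  proof (intro Liminf_mono always_eventually allI)
    fix n
    have "sum (f n) F = infsum (f n) F" using F by simp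
    also have "\<dots> \<le> infsum (f n) A"
      using F by (intro infsum_mono_neutral) auto
    finally show "sum (f n) F \<le> infsum (f n) A" .
  qed
  finally show "sum g F \<le> liminf (\<lambda>n. infsum (f n) A)" .
qed

lemma liminf_add_ennreal:
  fixes f g :: "nat \<Rightarrow> ennreal"
  shows "liminf f + liminf g \<le> liminf (\<lambda>n. f n + g n)"
proof -
  have "liminf f + liminf g = (SUP n. (INF k\<in>{n..}. f k) + (INF k\<in>{n..}. g k))"
    unfolding liminf_SUP_INF
    by (intro ennreal_SUP_add[symmetric]) (auto simp: incseq_def intro!: INF_superset_mono)
  also have "\<dots> \<le> liminf (\<lambda>n. f n + g n)"
    unfolding liminf_SUP_INF
    by (intro SUP_mono) (auto intro!: INF_greatest add_mono INF_lower)
  finally show ?thesis .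
qed

lemma infsum_divide_ennreal:
  fixes f :: "'c \<Rightarrow> ennreal"
  shows "infsum f A / c = infsum (\<lambda>x. f x / c) A"
proof -
  have "sum f F / c = (\<Sum>x\<in>F. f x / c)" for F
    by (induction F rule: infinite_finite_induct) (auto simp: add_divide_distrib_ennreal)
  thus ?thesis by (simp add: nonneg_infsum_complete SUP_divide_ennreal)
qed

lemma ennreal_infsum:
  assumes "f summable_on A" "\<And>x. x \<in> A \<Longrightarrow> 0 \<le> f x"
  shows "infsum (\<lambda>x. ennreal (f x)) A = ennreal (infsum f A)"
proof -
  have "sum (\<lambda>x. ennreal (f x)) F = ennreal (sum f F)" if "F \<subseteq> A" for F
    using assms(2) that by (intro sum_ennreal) auto
  note * = this
  have "infsum (\<lambda>x. ennreal (f x)) A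
      = (SUP F\<in>{F. finite F \<and> F \<subseteq> A}. sum (\<lambda>x. ennreal (f x)) F)"
    by (rule nonneg_infsum_complete) simp
  also have "\<dots> = (SUP F\<in>{F. finite F \<and> F \<subseteq> A}. ennreal (sum f F))"
    by (intro SUP_cong refl) (simp add: *)
  also have "\<dots> = ennreal (infsum f A)"
    by (rule infsum_nonneg_is_SUPREMUM_ennreal[OF assms, symmetric])
  finally show ?thesis .
qed

lemma infsum_zero_outside:
  assumes "finite K" "\<And>x. x \<notin> K \<Longrightarrow> f x = 0"
  shows "infsum f UNIV = sum f K"
proof -
  have "infsum f UNIV = infsum f K"
    using assms by (intro infsum_cong_neutral) auto
  thus ?thesis using assms by simp
qed

lemma le_liminf_trans:
  fixes X :: "nat \<Rightarrow> ennreal"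
  assumes "g \<le> liminf X" "eventually (\<lambda>n. X n \<le> c) sequentially"
  shows "g \<le> c"
  using order_trans[OF assms(1) Liminf_mono[OF assms(2)]] by (simp add: Liminf_const)

text \<open>Prescribing the first member lets the support of a datum lie in every member.\<close>

lemma countable_exhaustion:
  assumes "finite K"
  obtains A :: "nat \<Rightarrow> 'c::countable set" where
    "\<And>n. finite (A n)" "incseq A" "(\<Union>n. A n) = UNIV" "A 0 = K"
proof
  define A where "A n = K \<union> {x::'c. to_nat x < n}" for n
  have "finite {x::'c. to_nat x < n}" for n
    using finite_vimageI[of "{..<n}" "to_nat :: 'c \<Rightarrow> nat"] by (simp add: vimage_def)
  thus "finite (A n)" for n using assms by (simp add: A_def)
  show "incseq A" unfolding incseq_def A_def by auto
  show "(\<Union>n. A n) = UNIV" unfolding A_def by auto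
  show "A 0 = K" by (simp add: A_def)
qed

lemma exhaustion_contains_finite:
  assumes "incseq A" "(\<Union>n. A n) = UNIV" "finite S"
  obtains N :: nat where "S \<subseteq> A N"
proof -
  have "\<exists>N. S \<subseteq> A N" using \<open>finite S\<close>
  proof (induction S)
    case (insert x S)
    then obtain N where N: "S \<subseteq> A N" by blast
    obtain M where M: "x \<in> A M" using assms(2) by blast
    have "A N \<subseteq> A (max N M)" "A M \<subseteq> A (max N M)"
      using assms(1) by (auto simp: incseq_def)
    thus ?case using N M by blast
  qed auto
  thus ?thesis using that by blast
qed

text \<open>If both pairs are ordered alike, \<open>min\<close> and \<open>max\<close> only permute
  the two squares. If they are ordered oppositely, the right side exceeds the left by
  \<open>2 * (t - s) * (s' - t')\<close> in the notation of \<open>*\<close>. Applied along edges,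
  this is submodularity of the energy.\<close>

lemma min_max_square_le:
  fixes p q p' q' :: real
  shows "(min p q - min p' q')\<^sup>2 + (max p q - max p' q')\<^sup>2 \<le> (p - p')\<^sup>2 + (q - q')\<^sup>2"
proof -
  have *: "(s - t')\<^sup>2 + (t - s')\<^sup>2 \<le> (s - s')\<^sup>2 + (t - t')\<^sup>2" if "s \<le> t" "t' \<le> s'" for s t s' t' :: real
    using mult_nonneg_nonneg[of "t - s" "s' - t'"] that
    by (simp add: power2_eq_square algebra_simps)
  show ?thesis
    using *[of p q q' p'] *[of q p p' q']
    by (cases "p \<le> q"; cases "p' \<le> q'") (auto simp: min_def max_def add.commute)
qed

lemma positive_part_square_le:
  fixes p q :: real
  shows "(max p 0 - max q 0)\<^sup>2 \<le> (p - q)\<^sup>2"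
  unfolding abs_le_square_iff[symmetric] by (simp add: max_def)

subsection \<open>Comparison and Perron solutions\<close>

locale nonlinear_graph =
  fixes b :: "'a::countable \<Rightarrow> 'a \<Rightarrow> real" and m W :: "'a \<Rightarrow> real" and \<phi> :: "real \<Rightarrow> real"
  assumes graph: "weighted_graph b"
    and m_pos: "0 < m x"
    and W_pos: "0 < W x"
    and phi_cont: "continuous_on UNIV \<phi>"
    and phi_mono: "strict_mono \<phi>"
    and phi_zero: "\<phi> 0 = 0"
begin

lemma b_nonneg: "0 \<le> b x y"
  and b_sym: "b x y = b y x"
  and b_summable: "(\<lambda>y. b x y) summable_on UNIV"
  using graph unfolding weighted_graph_def by blast+

definition deg :: "'a \<Rightarrow> real" where
  "deg x = (\<Sum>\<^sub>\<infinity>y. b x y)"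

lemma formal_dom_bounded:
  assumes "\<And>x. \<bar>f x\<bar> \<le> c"
  shows "f \<in> formal_dom b"
  unfolding formal_dom_def
proof (intro CollectI allI)
  fix x
  have "(\<lambda>y. b x y * c) summable_on UNIV"
    by (intro summable_on_cmult_left b_summable)
  thus "(\<lambda>y. b x y * \<bar>f y\<bar>) summable_on UNIV"
    by (rule summable_on_comparison_test)
      (auto intro!: mult_left_mono b_nonneg mult_nonneg_nonneg assms)
qed

lemma summable_nbh:
  assumes "f \<in> formal_dom b"
  shows "(\<lambda>y. b x y * f y) summable_on UNIV"
proof (rule abs_summable_summable)
  show "(\<lambda>y. norm (b x y * f y)) summable_on UNIV"
    using assms by (simp add: formal_dom_def abs_mult b_nonneg)
qed

text \<open>The splitting isolates the value at \<open>x\<close> from the neighbour sum, which is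
  monotone in the function.\<close>

lemma Lap_eq:
  assumes "f \<in> formal_dom b"
  shows "m x * Lap b m f x = deg x * f x - (\<Sum>\<^sub>\<infinity>y. b x y * f y)"
proof -
  have "(\<Sum>\<^sub>\<infinity>y. b x y * (f x - f y)) = (\<Sum>\<^sub>\<infinity>y. b x y * f x - b x y * f y)"
    by (simp add: algebra_simps)
  also have "\<dots> = (\<Sum>\<^sub>\<infinity>y. b x y * f x) - (\<Sum>\<^sub>\<infinity>y. b x y * f y)"
    by (intro infsum_diff_real summable_on_cmult_left b_summable summable_nbh assms)
  also have "(\<Sum>\<^sub>\<infinity>y. b x y * f x) = deg x * f x"
    by (simp add: infsum_cmult_left' deg_def)
  finally show ?thesis using m_pos[of x] by (simp add: Lap_def)
qed

lemma nbh_mono: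
  assumes "f \<in> formal_dom b" "g \<in> formal_dom b" "\<And>y. f y \<le> g y"
  shows "(\<Sum>\<^sub>\<infinity>y. b x y * f y) \<le> (\<Sum>\<^sub>\<infinity>y. b x y * g y)"
  using assms by (intro infsum_mono summable_nbh mult_left_mono b_nonneg)

lemma Lap_eq_iff:
  assumes "f \<in> formal_dom b"
  shows "Lap b m f x = c \<longleftrightarrow> deg x * f x - (\<Sum>\<^sub>\<infinity>y. b x y * f y) = m x * c"
  unfolding Lap_eq[OF assms, symmetric] using m_pos[of x] by auto

lemma phi_le_iff: "\<phi> s \<le> \<phi> t \<longleftrightarrow> s \<le> t" and phi_less_iff: "\<phi> s < \<phi> t \<longleftrightarrow> s < t"
  using phi_mono by (auto simp: strict_mono_less_eq strict_mono_less)

lemma formal_dom_add_const: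
  assumes "f \<in> formal_dom b"
  shows "(\<lambda>x. f x + c) \<in> formal_dom b"
  unfolding formal_dom_def
proof (intro CollectI allI)
  fix x
  have "(\<lambda>y. b x y * \<bar>f y\<bar> + b x y * \<bar>c\<bar>) summable_on UNIV"
    using assms by (intro summable_on_add summable_on_cmult_left b_summable) (auto simp: formal_dom_def)
  thus "(\<lambda>y. b x y * \<bar>f y + c\<bar>) summable_on UNIV"
    by (rule summable_on_comparison_test)
      (auto intro!: mult_left_mono b_nonneg mult_nonneg_nonneg simp flip: distrib_left)
qed

lemma Lap_add_const: "Lap b m (\<lambda>x. f x + c) = Lap b m f"
  by (simp add: Lap_def fun_eq_iff)

text \<open>Suppose \<open>u - h\<close> has a positive maximum \<open>M\<close> over
  \<open>K\<close>, attained at \<open>z\<close>. Then \<open>u - M\<close> lies below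
  \<open>h\<close> everywhere and touches it at \<open>z\<close>, so
  \<open>Lap b m h z \<le> Lap b m u z\<close>; but \<open>h z < u z\<close> and strict monotonicity
  of \<open>\<phi>\<close> force the opposite strict inequality.\<close>

lemma comparison:
  assumes K: "finite K"
    and u: "u \<in> formal_dom b" and h: "h \<in> formal_dom b"
    and sub: "\<And>x. x \<in> K \<Longrightarrow> Lap b m u x \<le> \<phi> (f x - W x * u x)"
    and super: "\<And>x. x \<in> K \<Longrightarrow> \<phi> (f' x - W x * h x) \<le> Lap b m h x"
    and le: "\<And>x. x \<in> K \<Longrightarrow> f x \<le> f' x"
    and off: "\<And>x. x \<notin> K \<Longrightarrow> u x \<le> h x"
  shows "u x \<le> h x"
proof (rule ccontr)
  assume *: "\<not> u x \<le> h x"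
  hence "x \<in> K" using off by blast
  define M where "M = Max ((\<lambda>y. u y - h y) ` K)"
  have le_M: "u y - h y \<le> M" if "y \<in> K" for y
    unfolding M_def using K that by auto
  have M_pos: "0 < M" using le_M[OF \<open>x \<in> K\<close>] * by linarith
  have "M \<in> (\<lambda>y. u y - h y) ` K"
    unfolding M_def using K \<open>x \<in> K\<close> by (intro Max_in) auto
  then obtain z where z: "z \<in> K" "u z - h z = M" by auto
  have all_M: "u y - M \<le> h y" for y
    using le_M[of y] off[of y] M_pos by (cases "y \<in> K") auto
  have uM: "(\<lambda>y. u y - M) \<in> formal_dom b"
    using formal_dom_add_const[OF u, of "- M"] by simp
  have "m z * Lap b m h z = deg z * h z - (\<Sum>\<^sub>\<infinity>y. b z y * h y)"
    by (rule Lap_eq[OF h])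
  also have "\<dots> \<le> deg z * (u z - M) - (\<Sum>\<^sub>\<infinity>y. b z y * (u y - M))"
    using nbh_mono[OF uM h all_M, of z] z by (simp add: algebra_simps)
  also have "\<dots> = m z * Lap b m (\<lambda>y. u y + - M) z"
    using Lap_eq[OF uM] by simp
  also have "\<dots> = m z * Lap b m u z" by (simp only: Lap_add_const)
  finally have "Lap b m h z \<le> Lap b m u z" using m_pos[of z] by simp
  also have "\<dots> \<le> \<phi> (f z - W z * u z)" using sub z by blast
  also have "\<dots> < \<phi> (f' z - W z * h z)"
  proof -
    have "W z * h z < W z * u z" using W_pos[of z] z M_pos by simp
    thus ?thesis using le[OF z(1)] by (simp add: phi_less_iff)
  qed
  also have "\<dots> \<le> Lap b m h z" using super z by blast
  finally show False by simp
qed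

text \<open>For finite \<open>K\<close> containing the support of \<open>f\<close>, this is the
  Euler-Lagrange equation of the resolvent energy among functions vanishing off \<open>K\<close>;
  see \<open>strong_min\<close>.\<close>

definition solves :: "'a set \<Rightarrow> ('a \<Rightarrow> real) \<Rightarrow> ('a \<Rightarrow> real) \<Rightarrow> bool" where
  "solves K f u \<longleftrightarrow> (\<forall>x. x \<notin> K \<longrightarrow> u x = 0) \<and> (\<forall>x\<in>K. Lap b m u x = \<phi> (f x - W x * u x))"

lemma bdd_formal_dom: "(\<And>x. 0 \<le> u x \<and> u x \<le> a) \<Longrightarrow> u \<in> formal_dom b"
  by (rule formal_dom_bounded[where c = a]) auto

text \<open>Perron's method: the pointwise supremum of all subsolutions with values in \<open>[0, a]\<close>
  is a solution.\<close>

lemma solves_exists: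
  assumes f0: "\<And>x. 0 \<le> f x" and fa: "\<And>x. f x \<le> a * W x"
  obtains u where "solves K f u" "\<And>x. 0 \<le> u x \<and> u x \<le> a"
proof -
  define S where "S = {w. (\<forall>x. 0 \<le> w x \<and> w x \<le> a) \<and> (\<forall>x. x \<notin> K \<longrightarrow> w x = 0) \<and>
    (\<forall>x\<in>K. deg x * w x - (\<Sum>\<^sub>\<infinity>y. b x y * w y) \<le> m x * \<phi> (f x - W x * w x))}"
  define u where "u x = (SUP w\<in>S. w x)" for x
  \<comment> \<open>The carrier is nonempty, and at any point \<open>0 \<le> f \<le> a * W\<close>
    with \<open>W > 0\<close> forces the sign of \<open>a\<close>.\<close>
  have "0 \<le> a"
    using f0[of undefined] fa[of undefined] W_pos[of undefined]
    by (meson order_trans zero_le_mult_iff linorder_not_less order.strict_implies_order)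
  hence zero_S: "(\<lambda>_. 0) \<in> S"
    unfolding S_def using f0 m_pos phi_le_iff[of 0] by (auto simp: phi_zero less_imp_le)
  have S_le: "w x \<le> a" "0 \<le> w x" if "w \<in> S" for w x using that unfolding S_def by auto
  have S_dom: "w \<in> formal_dom b" if "w \<in> S" for w
    using S_le[OF that] by (intro bdd_formal_dom) auto
  have bdd: "bdd_above ((\<lambda>w. w x) ` S)" for x using S_le by (intro bdd_aboveI2)
  have u_ge: "w x \<le> u x" if "w \<in> S" for w x
    unfolding u_def by (rule cSUP_upper[OF that bdd])
  have u_bd: "0 \<le> u x \<and> u x \<le> a" for x
  proof
    show "0 \<le> u x" using u_ge[OF zero_S] .
    show "u x \<le> a" unfolding u_def using zero_S S_le by (intro cSUP_least) auto
  qed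
  have u_dom: "u \<in> formal_dom b" by (rule bdd_formal_dom[OF u_bd])
  have u_off: "u x = 0" if "x \<notin> K" for x
  proof -
    have "(\<lambda>w. w x) ` S = {0}" using zero_S that by (auto simp: S_def)
    thus ?thesis by (simp add: u_def)
  qed
  \<comment> \<open>\<open>P x t\<close> is the defect in the subsolution inequality at
    \<open>x\<close> when the value there is \<open>t\<close> and the neighbours carry the values of
    \<open>u\<close>; the equation reads \<open>P x (u x) = 0\<close>.\<close>
  define P where "P x t = m x * \<phi> (f x - W x * t) - deg x * t + (\<Sum>\<^sub>\<infinity>y. b x y * u y)" for x t
  have P_cont: "isCont (P x) t" for x t
    unfolding P_def
    by (intro continuous_intros continuous_on_interior[of UNIV]
      continuous_within_compose2[of _ _ "\<lambda>t. f x - W x * t" \<phi>] isCont_o2[of _ _ \<phi>])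
      (use phi_cont in \<open>auto simp: continuous_on_eq_continuous_at\<close>)
  \<comment> \<open>Enlarging the neighbours from \<open>w\<close> to \<open>u\<close> preserves the
    sign for each \<open>w \<in> S\<close>; as \<open>u x\<close> is a limit of values
    \<open>w x\<close>, continuity of \<open>P x\<close> does the rest.\<close>
  have sub: "0 \<le> P x (u x)" if "x \<in> K" for x
  proof -
    have *: "0 \<le> P x (w x)" if "w \<in> S" for w
    proof -
      have "(\<Sum>\<^sub>\<infinity>y. b x y * w y) \<le> (\<Sum>\<^sub>\<infinity>y. b x y * u y)"
        by (intro nbh_mono S_dom u_dom u_ge that)
      thus ?thesis using that \<open>x \<in> K\<close> unfolding S_def P_def by fastforce
    qed
    have "u x \<in> closure ((\<lambda>w. w x) ` S)"
      unfolding u_def using zero_S bdd by (intro closure_contains_Sup) auto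
    then obtain s where s: "\<And>n. s n \<in> (\<lambda>w. w x) ` S" "s \<longlonglongrightarrow> u x"
      unfolding closure_sequential by auto
    have "(\<lambda>n. P x (s n)) \<longlonglongrightarrow> P x (u x)"
      by (rule isCont_tendsto_compose[OF P_cont s(2)])
    moreover have "0 \<le> P x (s n)" for n using s(1)[of n] * by auto
    ultimately show ?thesis by (intro LIMSEQ_le_const) auto
  qed
  have "P x (u x) = 0" if x: "x \<in> K" for x
  proof (rule ccontr)
    assume "P x (u x) \<noteq> 0"
    hence pos: "0 < P x (u x)" using sub[OF x] by simp
    \<comment> \<open>At the ceiling \<open>a\<close> no neighbour is higher, so the Laplacian is
      nonnegative while \<open>\<phi> (f x - W x * a) \<le> 0\<close>. A positive defect thus leaves
      room above \<open>u x\<close>.\<close>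
    have "u x \<noteq> a"
    proof
      assume ua: "u x = a"
      have "(\<Sum>\<^sub>\<infinity>y. b x y * u y) \<le> (\<Sum>\<^sub>\<infinity>y. b x y * a)"
        using u_bd \<open>0 \<le> a\<close> by (intro nbh_mono u_dom bdd_formal_dom[of _ a]) auto
      also have "\<dots> = deg x * a" by (simp add: infsum_cmult_left' deg_def)
      finally have "P x a \<le> m x * \<phi> (f x - W x * a)" by (simp add: P_def)
      also have "\<dots> \<le> m x * \<phi> 0"
        using fa[of x] m_pos[of x] by (intro mult_left_mono) (auto simp: phi_le_iff mult.commute)
      finally show False using pos ua by (simp add: phi_zero)
    qed
    hence "u x < a" using u_bd[of x] by linarith
    have "eventually (\<lambda>t. 0 < P x t) (at (u x))"
      using P_cont[of "u x" x] pos by (auto simp: isCont_def order_tendsto_iff)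
    hence "eventually (\<lambda>t. 0 < P x t) (at_right (u x))"
      unfolding eventually_at_split ..
    moreover have "eventually (\<lambda>t. t \<in> {u x<..<a}) (at_right (u x))"
      by (rule eventually_at_right_real[OF \<open>u x < a\<close>])
    ultimately have "eventually (\<lambda>t. 0 < P x t \<and> t \<in> {u x<..<a}) (at_right (u x))"
      by (rule eventually_conj)
    then obtain t where t: "0 < P x t" "u x < t" "t < a"
      using eventually_happens'[OF trivial_limit_at_right_real] by fastforce
    \<comment> \<open>Raising \<open>u\<close> at \<open>x\<close> alone does not decrease any
      neighbour sum, and \<open>P x t > 0\<close> covers \<open>x\<close> itself, so
      \<open>w\<close> is again in \<open>S\<close>, although it exceeds the supremum at
      \<open>x\<close>.\<close>
    define w where "w = u(x := t)"
    have w_ge: "u y \<le> w y" for y using t by (simp add: w_def)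
    have w_bd: "0 \<le> w y \<and> w y \<le> a" for y using u_bd[of y] u_bd[of x] t by (auto simp: w_def)
    have nb: "(\<Sum>\<^sub>\<infinity>z. b y z * u z) \<le> (\<Sum>\<^sub>\<infinity>z. b y z * w z)" for y
      by (intro nbh_mono u_dom bdd_formal_dom[OF w_bd] w_ge)
    have "deg y * w y - (\<Sum>\<^sub>\<infinity>z. b y z * w z) \<le> m y * \<phi> (f y - W y * w y)" if "y \<in> K" for y
      using nb[of y] t(1) sub[OF that] by (auto simp: w_def P_def)
    hence "w \<in> S" using w_bd u_off x unfolding S_def by (auto simp: w_def)
    from u_ge[OF this, of x] show False using t by (simp add: w_def)
  qed
  hence "Lap b m u x = \<phi> (f x - W x * u x)" if "x \<in> K" for x
    using that unfolding Lap_eq_iff[OF u_dom] P_def by fastforce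
  hence "solves K f u" unfolding solves_def using u_off by blast
  thus ?thesis using u_bd that by blast
qed

subsection \<open>Energy functionals\<close>

lemma Phi_zero: "Phi \<phi> 0 = 0"
  by (simp add: Phi_def)

text \<open>The interval contains \<open>0\<close> and has \<open>s\<close> in its interior, so the
  derivative within it is a derivative at \<open>s\<close>.\<close>

lemma Phi_has_derivative: "(Phi \<phi> has_real_derivative 2 * \<phi> s) (at s)"
proof -
  have 1: "((\<lambda>u. LBINT t=ereal 0..u. 2 * \<phi> t) has_vector_derivative 2 * \<phi> s)
      (at s within {- \<bar>s\<bar> - 1..\<bar>s\<bar> + 1})"
    by (rule interval_integral_FTC2)
      (auto intro!: continuous_intros continuous_on_subset[OF phi_cont])
  have "- \<bar>s\<bar> - 1 < s" "s < \<bar>s\<bar> + 1" by linarith+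
  hence "s \<in> interior {- \<bar>s\<bar> - 1..\<bar>s\<bar> + 1}" by (simp only: interior_atLeastAtMost_real) auto
  from 1[unfolded at_within_interior[OF this]]
  have "((\<lambda>u. LBINT t=ereal 0..u. 2 * \<phi> t) has_vector_derivative 2 * \<phi> s) (at s)" .
  thus ?thesis unfolding has_real_derivative_iff_has_vector_derivative Phi_def[abs_def] .
qed

lemma Phi_isCont: "isCont (Phi \<phi>) s"
  by (rule DERIV_isCont[OF Phi_has_derivative])

text \<open>Strict convexity: the chord slope is \<open>2 * \<phi> z\<close> for some
  \<open>z\<close> strictly between \<open>s\<close> and \<open>t\<close>, and \<open>\<phi>\<close>
  is strictly increasing.\<close>

lemma Phi_tangent_strict:
  assumes "s \<noteq> t"
  shows "Phi \<phi> s + 2 * \<phi> s * (t - s) < Phi \<phi> t"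
proof (cases "s < t")
  case True
  then obtain z where z: "s < z" "z < t" "Phi \<phi> t - Phi \<phi> s = (t - s) * (2 * \<phi> z)"
    using MVT2[OF True, of "Phi \<phi>" "\<lambda>z. 2 * \<phi> z"] Phi_has_derivative by blast
  have "(t - s) * (2 * \<phi> s) < (t - s) * (2 * \<phi> z)"
    using True z by (intro mult_strict_left_mono) (auto simp: phi_less_iff)
  thus ?thesis using z by (simp add: algebra_simps)
next
  case False
  with assms have ts: "t < s" by simp
  then obtain z where z: "t < z" "z < s" "Phi \<phi> s - Phi \<phi> t = (s - t) * (2 * \<phi> z)"
    using MVT2[OF ts, of "Phi \<phi>" "\<lambda>z. 2 * \<phi> z"] Phi_has_derivative by blast
  have "(s - t) * (2 * \<phi> z) < (s - t) * (2 * \<phi> s)"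
    using ts z by (intro mult_strict_left_mono) (auto simp: phi_less_iff)
  thus ?thesis using z by (simp add: algebra_simps)
qed

lemma Phi_tangent: "Phi \<phi> s + 2 * \<phi> s * (t - s) \<le> Phi \<phi> t"
  using Phi_tangent_strict[of s t] by (cases "s = t") auto

lemma Phi_nonneg: "0 \<le> Phi \<phi> s"
  using Phi_tangent[of 0 s] by (simp add: Phi_zero phi_zero)

text \<open>\<open>Phi \<phi>\<close> grows away from \<open>0\<close> on either side: the sign
  condition makes the linear term of the tangent at \<open>s\<close> nonnegative.\<close>

lemma Phi_mono_abs:
  assumes "0 \<le> s * t" "\<bar>s\<bar> \<le> \<bar>t\<bar>"
  shows "Phi \<phi> s \<le> Phi \<phi> t"
proof -
  have "0 \<le> \<phi> s * (t - s)"
  proof (cases "0 \<le> s")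
    case True
    have "s = 0 \<or> s \<le> t" using assms True by (auto simp: zero_le_mult_iff)
    thus ?thesis using True phi_le_iff[of 0 s] by (auto simp: phi_zero)
  next
    case False
    hence "t \<le> s" using assms by (auto simp: zero_le_mult_iff)
    thus ?thesis using False phi_le_iff[of s 0] by (simp add: phi_zero mult_nonpos_nonpos)
  qed
  thus ?thesis using Phi_tangent[of s t] by simp
qed

text \<open>The linear terms of the tangent inequalities at the midpoint cancel on addition.\<close>

lemma Phi_midpoint_strict:
  assumes "s \<noteq> t"
  shows "Phi \<phi> ((s + t) / 2) < (Phi \<phi> s + Phi \<phi> t) / 2"
proof -
  have "Phi \<phi> ((s + t) / 2) + 2 * \<phi> ((s + t) / 2) * (s - (s + t) / 2) < Phi \<phi> s"
       "Phi \<phi> ((s + t) / 2) + 2 * \<phi> ((s + t) / 2) * (t - (s + t) / 2) < Phi \<phi> t"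
    using assms by (intro Phi_tangent_strict; simp add: field_simps)+
  thus ?thesis by (simp add: field_simps)
qed

text \<open>With the factor \<open>1/2\<close> inside the summand, energy inequalities reduce to
  inequalities edge by edge.\<close>

definition edge :: "('a \<Rightarrow> real) \<Rightarrow> 'a \<times> 'a \<Rightarrow> real" where
  "edge u = (\<lambda>(x, y). b x y * (u x - u y)\<^sup>2 / 2)"

definition pot :: "('a \<Rightarrow> real) \<Rightarrow> ('a \<Rightarrow> real) \<Rightarrow> 'a \<Rightarrow> real" where
  "pot f u x = Phi \<phi> (f x - W x * u x) * (m x / W x)"

abbreviation "E f \<equiv> resolvent_energy b m \<phi> W f"

lemma edge_nonneg: "0 \<le> edge u p"
  by (cases p) (simp add: edge_def b_nonneg)

lemma pot_nonneg: "0 \<le> pot f u x"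
  using m_pos[of x] W_pos[of x] by (simp add: pot_def Phi_nonneg)

lemma energy_eq: "energy b u = (\<Sum>\<^sub>\<infinity>p. ennreal (edge u p))"
  unfolding energy_def infsum_divide_ennreal edge_def
  by (intro infsum_cong) (auto simp: divide_ennreal[symmetric] b_nonneg)

lemma kappa_eq: "kappa m \<phi> W f u = (\<Sum>\<^sub>\<infinity>x. ennreal (pot f u x))"
  unfolding kappa_def pot_def ..

lemma energy_liminf:
  assumes "\<And>x. (\<lambda>n. u n x) \<longlonglongrightarrow> v x"
  shows "energy b v \<le> liminf (\<lambda>n. energy b (u n))"
  unfolding energy_eq edge_def
  by (intro infsum_ennreal_liminf) (auto intro!: tendsto_intros assms split: prod.splits)

lemma pot_tendsto:
  assumes "(\<lambda>n. u n x) \<longlonglongrightarrow> v x"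
  shows "(\<lambda>n. pot f (u n) x) \<longlonglongrightarrow> pot f v x"
  unfolding pot_def
  by (intro tendsto_intros isCont_tendsto_compose[OF Phi_isCont] assms)

lemma kappa_liminf:
  assumes "\<And>x. (\<lambda>n. u n x) \<longlonglongrightarrow> v x"
  shows "kappa m \<phi> W f v \<le> liminf (\<lambda>n. kappa m \<phi> W f (u n))"
  unfolding kappa_eq
  by (intro infsum_ennreal_liminf tendsto_ennrealI pot_tendsto assms)

lemma E_liminf:
  assumes "\<And>x. (\<lambda>n. u n x) \<longlonglongrightarrow> v x"
  shows "E f v \<le> liminf (\<lambda>n. E f (u n))"
  unfolding resolvent_energy_def
  by (rule order_trans[OF add_mono[OF energy_liminf kappa_liminf] liminf_add_ennreal])
    (rule assms)+

lemma energy_pair_le: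
  assumes "\<And>p. edge u1 p + edge u2 p \<le> edge v1 p + edge v2 p"
  shows "energy b u1 + energy b u2 \<le> energy b v1 + energy b v2"
  unfolding energy_eq infsum_add[OF summable_on_ennreal_valued summable_on_ennreal_valued, symmetric]
  by (intro infsum_mono) (use assms in \<open>auto simp: edge_nonneg simp flip: ennreal_plus\<close>)

section \<open>Green's formula and strong minimality on finite sets\<close>

definition bil :: "('a \<Rightarrow> real) \<Rightarrow> ('a \<Rightarrow> real) \<Rightarrow> 'a \<times> 'a \<Rightarrow> real" where
  "bil u w = (\<lambda>(x, y). b x y * (u x - u y) * (w x - w y) / 2)"

lemma Cc_bounded:
  assumes "u \<in> Cc"
  obtains c where "\<And>x. \<bar>u x\<bar> \<le> c"
proof
  fix x
  have fin: "finite (insert 0 ((\<lambda>x. \<bar>u x\<bar>) ` {x. u x \<noteq> 0}))" using assms by (simp add: Cc_def)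
  show "\<bar>u x\<bar> \<le> Max (insert 0 ((\<lambda>x. \<bar>u x\<bar>) ` {x. u x \<noteq> 0}))"
    by (rule Max_ge[OF fin]) auto
qed

lemma Cc_formal_dom: "u \<in> Cc \<Longrightarrow> u \<in> formal_dom b"
  using Cc_bounded formal_dom_bounded by metis

lemma CcI: "finite K \<Longrightarrow> (\<And>x. x \<notin> K \<Longrightarrow> u x = 0) \<Longrightarrow> u \<in> Cc"
  unfolding Cc_def using finite_subset[of "{x. u x \<noteq> 0}" K] by auto

text \<open>Row \<open>x\<close> sums to \<open>w x * (m x * Lap b m u x)\<close>, and only the
  finitely many rows in \<open>K\<close> can be nonzero, which also gives joint summability over
  pairs.\<close>

lemma has_sum_left:
  assumes u: "u \<in> formal_dom b" and K: "finite K" "\<And>x. x \<notin> K \<Longrightarrow> w x = 0"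
  shows "((\<lambda>(x, y). w x * (b x y * (u x - u y))) has_sum (\<Sum>x\<in>K. w x * (m x * Lap b m u x))) UNIV"
proof -
  have row: "((\<lambda>y. w x * (b x y * (u x - u y))) has_sum w x * (m x * Lap b m u x)) UNIV" for x
  proof -
    have "(\<lambda>y. b x y * u x - b x y * u y) summable_on UNIV"
      using summable_on_add[OF summable_on_cmult_left[OF b_summable]
          iffD2[OF summable_on_uminus summable_nbh[OF u]]] by simp
    hence "(\<lambda>y. b x y * (u x - u y)) summable_on UNIV" by (simp only: right_diff_distrib)
    moreover have "m x * Lap b m u x = (\<Sum>\<^sub>\<infinity>y. b x y * (u x - u y))"
      using m_pos[of x] by (simp add: Lap_def)
    ultimately have "((\<lambda>y. b x y * (u x - u y)) has_sum m x * Lap b m u x) UNIV"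
      by (simp only: has_sum_infsum)
    thus ?thesis by (rule has_sum_cmult_right)
  qed
  have "((\<lambda>(x, y). w x * (b x y * (u x - u y))) has_sum (\<Sum>x\<in>K. w x * (m x * Lap b m u x))) (K \<times> UNIV)"
  proof (rule has_sum_SigmaI)
    show "(\<lambda>(x, y). w x * (b x y * (u x - u y))) summable_on K \<times> UNIV"
    proof -
      have "(\<lambda>(x, y). w x * (b x y * (u x - u y))) summable_on {x} \<times> UNIV" for x
      proof -
        have "bij_betw (Pair x) UNIV ({x} \<times> UNIV)" by (auto simp: bij_betw_def inj_on_def)
        from summable_on_reindex_bij_betw[OF this, of "\<lambda>(x, y). w x * (b x y * (u x - u y))"]
        show ?thesis using row[of x] by (auto simp: summable_on_def)
      qed
      hence "(\<lambda>(x, y). w x * (b x y * (u x - u y))) summable_on (\<Union>x\<in>K. {x} \<times> UNIV)"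
        using K(1) by (intro summable_on_finite_union_disjoint) auto
      thus ?thesis by (simp add: Sigma_def)
    qed
  qed (use row has_sum_finite[OF K(1)] in auto)
  moreover have wK: "x \<in> K" if "w x \<noteq> 0" for x using K(2) that by blast
  have "((\<lambda>(x, y). w x * (b x y * (u x - u y))) has_sum (\<Sum>x\<in>K. w x * (m x * Lap b m u x))) (K \<times> UNIV)
      \<longleftrightarrow> ?thesis"
    by (rule has_sum_cong_neutral) (auto dest: wK)
  ultimately show ?thesis by blast
qed

text \<open>The sum of \<open>has_sum_left\<close> is averaged with its image under exchanging
  \<open>x\<close> and \<open>y\<close>; symmetry of \<open>b\<close> merges the summands into
  \<open>bil u w\<close>.\<close>

lemma green:
  assumes u: "u \<in> formal_dom b" and K: "finite K" "\<And>x. x \<notin> K \<Longrightarrow> w x = 0"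
  shows "(bil u w has_sum (\<Sum>x\<in>K. w x * (m x * Lap b m u x))) UNIV"
proof -
  let ?S = "\<Sum>x\<in>K. w x * (m x * Lap b m u x)"
  have 1: "((\<lambda>(x, y). w x * (b x y * (u x - u y))) has_sum ?S) UNIV"
    by (rule has_sum_left[OF assms])
  hence "((\<lambda>(x, y). w y * (b y x * (u y - u x))) has_sum ?S) UNIV"
    using has_sum_swap[of "\<lambda>(x, y). w x * (b x y * (u x - u y))" UNIV UNIV ?S] by (simp add: case_prod_beta)
  from has_sum_add[OF 1 this]
  have "((\<lambda>p. 1/2 * ((\<lambda>(x, y). w x * (b x y * (u x - u y))) p + (\<lambda>(x, y). w y * (b y x * (u y - u x))) p))
      has_sum 1/2 * (?S + ?S)) UNIV" by (rule has_sum_cmult_right)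
  also have "(\<lambda>p. 1/2 * ((\<lambda>(x, y). w x * (b x y * (u x - u y))) p + (\<lambda>(x, y). w y * (b y x * (u y - u x))) p))
    = bil u w"
  proof
    fix p :: "'a \<times> 'a"
    obtain x y where p: "p = (x, y)" by (cases p)
    show "1/2 * ((\<lambda>(x, y). w x * (b x y * (u x - u y))) p + (\<lambda>(x, y). w y * (b y x * (u y - u x))) p) = bil u w p"
    proof -
      have "w x * (b x y * (u x - u y)) + w y * (b x y * (u y - u x)) = b x y * (u x - u y) * (w x - w y)"
        by (simp add: algebra_simps)
      thus ?thesis unfolding p bil_def b_sym[of y x] prod.case by simp
    qed
  qed
  finally show ?thesis by simp
qed

lemma edge_bil: "edge u = bil u u"
  by (simp add: edge_def bil_def power2_eq_square mult.assoc)

lemma edge_summable: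
  assumes "u \<in> Cc"
  shows "edge u summable_on UNIV"
proof -
  have fin: "finite {x. u x \<noteq> 0}" using assms by (simp add: Cc_def)
  have "(bil u u has_sum (\<Sum>x\<in>{x. u x \<noteq> 0}. u x * (m x * Lap b m u x))) UNIV"
    by (rule green[OF Cc_formal_dom[OF assms] fin]) simp
  thus ?thesis unfolding edge_bil summable_on_def by blast
qed

lemma energy_Cc: "u \<in> Cc \<Longrightarrow> energy b u = ennreal (infsum (edge u) UNIV)"
  unfolding energy_eq by (intro ennreal_infsum edge_summable edge_nonneg)

lemma kappa_Cc:
  assumes "finite K" "\<And>x. x \<notin> K \<Longrightarrow> u x = 0" "\<And>x. x \<notin> K \<Longrightarrow> f x = 0"
  shows "kappa m \<phi> W f u = ennreal (\<Sum>x\<in>K. pot f u x)"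
proof -
  have "kappa m \<phi> W f u = (\<Sum>x\<in>K. ennreal (pot f u x))"
    unfolding kappa_eq using assms by (intro infsum_zero_outside) (auto simp: pot_def Phi_zero)
  thus ?thesis by (simp add: pot_nonneg)
qed

text \<open>Expanding the energy of \<open>v = u + w\<close> leaves a cross term, which Green's
  formula evaluates as \<open>2 * S\<close>. Since \<open>u\<close> solves the equation, the tangent
  inequality for \<open>Phi\<close> shows that the potential sum of \<open>u\<close> exceeds that of
  \<open>v\<close> by at most \<open>2 * S\<close>. The retained \<open>energy b w\<close> later
  yields a Cauchy estimate.\<close>

lemma strong_min:
  assumes K: "finite K" and f: "\<And>x. x \<notin> K \<Longrightarrow> f x = 0" and u: "solves K f u"
    and v: "\<And>x. x \<notin> K \<Longrightarrow> v x = 0"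
  shows "E f u + energy b (\<lambda>x. v x - u x) \<le> E f v"
proof -
  define w where "w = (\<lambda>x. v x - u x)"
  have u0: "u x = 0" if "x \<notin> K" for x using u that by (simp add: solves_def)
  have w0: "w x = 0" if "x \<notin> K" for x using that by (simp add: w_def u0 v)
  have Cc: "u \<in> Cc" "v \<in> Cc" "w \<in> Cc" using CcI[OF K] u0 v w0 by blast+
  define S where "S = (\<Sum>x\<in>K. w x * (m x * Lap b m u x))"
  have bil: "(bil u w has_sum S) UNIV"
    unfolding S_def by (intro green Cc_formal_dom Cc K w0)
  have "edge v p = edge u p + edge w p + 2 * bil u w p" for p
  proof -
    obtain x y where p: "p = (x, y)" by (cases p)
    have "(v x - v y)\<^sup>2 = (u x - u y)\<^sup>2 + (w x - w y)\<^sup>2 + 2 * ((u x - u y) * (w x - w y))"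
      by (simp add: w_def power2_eq_square algebra_simps)
    thus ?thesis by (simp add: p edge_def bil_def distrib_left add_divide_distrib mult.assoc)
  qed
  hence "edge v = (\<lambda>p. edge u p + edge w p + 2 * bil u w p)" by blast
  moreover have "((\<lambda>p. edge u p + edge w p + 2 * bil u w p) has_sum
      infsum (edge u) UNIV + infsum (edge w) UNIV + 2 * S) UNIV"
    by (intro has_sum_add has_sum_cmult_right bil has_sum_infsum edge_summable Cc)
  ultimately have ev: "infsum (edge v) UNIV = infsum (edge u) UNIV + infsum (edge w) UNIV + 2 * S"
    by (metis infsumI)
  have "(\<Sum>x\<in>K. pot f u x) \<le> (\<Sum>x\<in>K. pot f v x + 2 * (w x * (m x * Lap b m u x)))"
  proof (rule sum_mono)
    fix x assume x: "x \<in> K"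
    have "Phi \<phi> (f x - W x * u x) + 2 * \<phi> (f x - W x * u x) * (- (W x * w x)) \<le> Phi \<phi> (f x - W x * v x)"
      using Phi_tangent[of "f x - W x * u x" "f x - W x * v x"] by (simp add: w_def algebra_simps)
    hence "Phi \<phi> (f x - W x * u x) * (m x / W x)
        \<le> (Phi \<phi> (f x - W x * v x) + 2 * \<phi> (f x - W x * u x) * (W x * w x)) * (m x / W x)"
      using m_pos[of x] W_pos[of x] by (intro mult_right_mono) auto
    \<comment> \<open>The factor \<open>W x\<close> from the change of argument cancels against the
      weight \<open>m x / W x\<close>, leaving the summand of \<open>S\<close>.\<close>
    also have "\<dots> = pot f v x + 2 * (w x * (m x * Lap b m u x))"
    proof -
      have "\<phi> (f x - W x * u x) = Lap b m u x" using x u by (simp add: solves_def)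
      moreover have "W x * w x * (m x / W x) = w x * m x" using W_pos[of x] by simp
      moreover have "(Phi \<phi> (f x - W x * v x) + 2 * \<phi> (f x - W x * u x) * (W x * w x)) * (m x / W x)
          = pot f v x + 2 * \<phi> (f x - W x * u x) * (W x * w x * (m x / W x))"
        unfolding pot_def by (simp only: distrib_right mult.assoc)
      ultimately show ?thesis by simp
    qed
    finally show "pot f u x \<le> pot f v x + 2 * (w x * (m x * Lap b m u x))"
      by (simp add: pot_def)
  qed
  also have "\<dots> = (\<Sum>x\<in>K. pot f v x) + 2 * S"
    by (simp add: sum.distrib S_def sum_distrib_left)
  finally have kv: "(\<Sum>x\<in>K. pot f u x) \<le> (\<Sum>x\<in>K. pot f v x) + 2 * S" .
  have nn: "0 \<le> infsum (edge z) UNIV" "0 \<le> (\<Sum>x\<in>K. pot f z x)" for z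
    by (auto intro!: infsum_nonneg sum_nonneg edge_nonneg pot_nonneg)
  have ku: "kappa m \<phi> W f u = ennreal (\<Sum>x\<in>K. pot f u x)"
    and kv': "kappa m \<phi> W f v = ennreal (\<Sum>x\<in>K. pot f v x)"
    by (rule kappa_Cc[OF K]; use u0 v f in blast)+
  show ?thesis
    unfolding resolvent_energy_def w_def[symmetric] energy_Cc[OF Cc(1)] energy_Cc[OF Cc(2)]
      energy_Cc[OF Cc(3)] ku kv'
    unfolding ennreal_plus[OF nn(1) nn(2), symmetric] ennreal_plus[OF add_nonneg_nonneg[OF nn(1) nn(2)] nn(1), symmetric]
    by (rule ennreal_leI) (use kv ev in linarith)
qed

lemma energy_parallelogram_le:
  assumes "\<And>p. edge u1 p + edge u2 p \<le> 2 * edge v1 p + 2 * edge v2 p"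
  shows "energy b u1 + energy b u2 \<le> (energy b v1 + energy b v1) + (energy b v2 + energy b v2)"
  unfolding energy_eq infsum_add[OF summable_on_ennreal_valued summable_on_ennreal_valued, symmetric]
  by (intro infsum_mono) (use assms in \<open>auto simp: edge_nonneg simp flip: ennreal_plus\<close>)

lemma energy_diff_commute: "energy b (\<lambda>x. u x - v x) = energy b (\<lambda>x. v x - u x)"
  unfolding energy_eq edge_def by (intro infsum_cong) (auto simp: power2_eq_square algebra_simps)

lemma Cc_resolvent_dom:
  assumes "u \<in> Cc" "f \<in> Cc"
  shows "u \<in> resolvent_dom b m \<phi> W f"
proof -
  have "energy b (\<lambda>_. 0) = 0" by (simp add: energy_eq edge_def case_prod_beta)
  hence "u \<in> finite_energy0 b"
    using assms energy_Cc[of u] unfolding finite_energy0_def finite_energy_def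
    by (auto intro!: exI[of _ "\<lambda>_. u"])
  moreover have "kappa m \<phi> W f u < \<infinity>"
    using assms by (subst kappa_Cc[of "{x. u x \<noteq> 0} \<union> {x. f x \<noteq> 0}"]) (auto simp: Cc_def)
  ultimately show ?thesis by (simp add: resolvent_dom_def)
qed

lemma E_finite: "u \<in> resolvent_dom b m \<phi> W f \<Longrightarrow> E f u < \<infinity>"
  by (auto simp: resolvent_dom_def finite_energy0_def finite_energy_def resolvent_energy_def)

subsection \<open>The Dirichlet resolvent\<close>

text \<open>\<open>v\<close> is approximated in energy by the functions \<open>min (F\<^sub>k\<^sup>+) (v\<^sup>+)\<close>, where
  \<open>F\<^sub>k\<close> is a sequence witnessing \<open>v \<in> \<D>\<^sub>0\<close>. The upper bound for the limit of their energies comes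
  from submodularity of \<open>\<Q>\<close> and the parallelogram identity, with Fatou's lemma applied to the
  other term on the left of either inequality.\<close>

lemma lower_bound_from_Cc:
  assumes f: "f \<in> Cc" "\<And>x. 0 \<le> f x" and v: "v \<in> resolvent_dom b m \<phi> W f"
    and c: "\<And>w. w \<in> Cc \<Longrightarrow> c \<le> E f w"
  shows "c \<le> E f v"
proof -
  from v have Qv: "energy b v < \<infinity>" and kv: "kappa m \<phi> W f v < \<infinity>"
    by (auto simp: resolvent_dom_def finite_energy0_def finite_energy_def)
  from v obtain F where F: "\<And>n. F n \<in> Cc" "\<And>x. (\<lambda>n. F n x) \<longlonglongrightarrow> v x"
    and QF: "(\<lambda>n. energy b (\<lambda>x. v x - F n x)) \<longlonglongrightarrow> 0"
    by (auto simp: resolvent_dom_def finite_energy0_def)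
  define S where "S = {x. f x \<noteq> 0}"
  have S: "finite S" using f by (simp add: S_def Cc_def)
  define v' where "v' x = max (v x) 0" for x
  define w where "w k x = min (max (F k x) 0) (v' x)" for k x
  define M where "M k x = max (max (F k x) 0) (v' x)" for k x
  \<comment> \<open>\<open>G k\<close> reflects \<open>F k\<close> in \<open>v\<close>:
    \<open>F k = v - e k\<close> and \<open>G k = v + e k\<close> span the parallelogram used
    below.\<close>
  define G where "G k x = 2 * v x - F k x" for k x
  define e where "e k x = v x - F k x" for k x
  have w_lim: "(\<lambda>k. w k x) \<longlonglongrightarrow> v' x" for x
  proof -
    have "(\<lambda>k. w k x) \<longlonglongrightarrow> min (max (v x) 0) (v' x)"
      unfolding w_def by (intro tendsto_intros F)
    thus ?thesis by (simp add: v'_def)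
  qed
  have M_lim: "(\<lambda>k. M k x) \<longlonglongrightarrow> v' x" for x
  proof -
    have "(\<lambda>k. M k x) \<longlonglongrightarrow> max (max (v x) 0) (v' x)"
      unfolding M_def by (intro tendsto_intros F)
    thus ?thesis by (simp add: v'_def)
  qed
  have G_lim: "(\<lambda>k. G k x) \<longlonglongrightarrow> v x" for x
  proof -
    have "(\<lambda>k. G k x) \<longlonglongrightarrow> 2 * v x - v x"
      unfolding G_def by (intro tendsto_intros F)
    thus ?thesis by simp
  qed
  \<comment> \<open>Since \<open>v' \<ge> 0\<close>, \<open>w k\<close> vanishes wherever
    \<open>F k\<close> does.\<close>
  have w_Cc: "w k \<in> Cc" for k
    using F(1)[of k] unfolding Cc_def
    by (auto simp: w_def v'_def elim!: rev_finite_subset)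
  have submod: "energy b (w k) + energy b (M k) \<le> energy b (F k) + energy b v'" for k
  proof (rule energy_pair_le)
    fix p :: "'a \<times> 'a"
    obtain x y where p: "p = (x, y)" by (cases p)
    have "(w k x - w k y)\<^sup>2 + (M k x - M k y)\<^sup>2
      \<le> (max (F k x) 0 - max (F k y) 0)\<^sup>2 + (v' x - v' y)\<^sup>2"
      unfolding w_def M_def by (rule min_max_square_le)
    also have "\<dots> \<le> (F k x - F k y)\<^sup>2 + (v' x - v' y)\<^sup>2"
      by (intro add_right_mono positive_part_square_le)
    finally have "b x y / 2 * ((w k x - w k y)\<^sup>2 + (M k x - M k y)\<^sup>2)
      \<le> b x y / 2 * ((F k x - F k y)\<^sup>2 + (v' x - v' y)\<^sup>2)"
      by (intro mult_left_mono) (auto simp: b_nonneg)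
    thus "edge (w k) p + edge (M k) p \<le> edge (F k) p + edge v' p"
      by (simp add: p edge_def algebra_simps)
  qed
  have Qv': "energy b v' < \<infinity>"
  proof -
    have "energy b v' \<le> energy b v"
      unfolding energy_eq edge_def v'_def
      by (intro infsum_mono)
        (auto intro!: ennreal_leI divide_right_mono mult_left_mono positive_part_square_le b_nonneg)
    thus ?thesis using Qv by simp
  qed
  have para: "energy b (F k) + energy b (G k)
      \<le> (energy b v + energy b v) + (energy b (e k) + energy b (e k))" for k
    by (rule energy_parallelogram_le)
      (auto simp: edge_def G_def e_def power2_eq_square field_simps split: prod.splits)
  define R where "R = (\<Sum>\<^sub>\<infinity>x\<in>UNIV - S. ennreal (pot f v x))"
  have split: "kappa m \<phi> W f z = ennreal (\<Sum>x\<in>S. pot f z x) + (\<Sum>\<^sub>\<infinity>x\<in>UNIV - S. ennreal (pot f z x))" for z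
    unfolding kappa_eq using infsum_Un_disjoint[of "\<lambda>x. ennreal (pot f z x)" S "UNIV - S"] S
    by (simp add: pot_nonneg)
  \<comment> \<open>Off the support of \<open>f\<close>, \<open>w k\<close> lies between
    \<open>0\<close> and \<open>v'\<close>, so its potential is at most that of \<open>v\<close>.
    The tail is thus bounded uniformly in \<open>k\<close>, and potentials pass to the limit only on
    the finite set \<open>S\<close>.\<close>
  have kw: "kappa m \<phi> W f (w k) \<le> ennreal (\<Sum>x\<in>S. pot f (w k) x) + R" for k
    unfolding split R_def
  proof (intro add_left_mono infsum_mono summable_on_ennreal_valued ennreal_leI)
    fix x assume "x \<in> UNIV - S"
    hence "f x = 0" by (simp add: S_def)
    moreover have "Phi \<phi> (- (W x * w k x)) \<le> Phi \<phi> (- (W x * v x))"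
    proof (cases "0 \<le> v x")
      case True
      thus ?thesis using W_pos[of x]
        by (intro Phi_mono_abs) (auto simp: w_def v'_def abs_mult)
    next
      case False
      hence "w k x = 0" by (simp add: w_def v'_def)
      thus ?thesis by (simp add: Phi_zero Phi_nonneg)
    qed
    ultimately show "pot f (w k) x \<le> pot f v x"
      using m_pos[of x] W_pos[of x] unfolding pot_def by (intro mult_right_mono) auto
  qed
  \<comment> \<open>The two energy inequalities are added to the bound by \<open>c\<close> instead
    of being solved for \<open>energy b (w k)\<close> and \<open>energy b (F k)\<close>, since
    subtraction in \<open>ennreal\<close> is truncated.\<close>
  have "c + energy b (M k) + energy b (G k)
      \<le> (ennreal (\<Sum>x\<in>S. pot f (w k) x) + R) + energy b v'
        + ((energy b v + energy b v) + (energy b (e k) + energy b (e k)))" (is "?L k \<le> ?R k") for k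
  proof -
    have "?L k \<le> (energy b (w k) + kappa m \<phi> W f (w k)) + energy b (M k) + energy b (G k)"
      using c[OF w_Cc[of k]] unfolding resolvent_energy_def by (intro add_right_mono)
    also have "\<dots> = kappa m \<phi> W f (w k) + (energy b (w k) + energy b (M k)) + energy b (G k)"
      by (simp add: ac_simps)
    also have "\<dots> \<le> (ennreal (\<Sum>x\<in>S. pot f (w k) x) + R) + (energy b (F k) + energy b v') + energy b (G k)"
      by (intro add_mono kw submod order_refl)
    also have "\<dots> = (ennreal (\<Sum>x\<in>S. pot f (w k) x) + R) + energy b v' + (energy b (F k) + energy b (G k))"
      by (simp add: ac_simps)
    also have "\<dots> \<le> ?R k"
      by (intro add_left_mono para)
    finally show ?thesis .
  qed
  note LR = this
  have "?R \<longlonglongrightarrow> (ennreal (\<Sum>x\<in>S. pot f v' x) + R) + energy b v'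
        + ((energy b v + energy b v) + (0 + 0))"
    using QF unfolding e_def[symmetric]
    by (intro tendsto_intros tendsto_ennrealI pot_tendsto w_lim) auto
  hence R_lim: "liminf ?R = (ennreal (\<Sum>x\<in>S. pot f v' x) + R) + energy b v' + (energy b v + energy b v)"
    by (simp add: lim_imp_Liminf)
  have "c + energy b v' + energy b v \<le> liminf (\<lambda>_. c) + liminf (\<lambda>k. energy b (M k)) + liminf (\<lambda>k. energy b (G k))"
    by (intro add_mono energy_liminf M_lim G_lim) (simp add: Liminf_const)
  also have "\<dots> \<le> liminf ?L"
    by (rule order_trans[OF add_right_mono[OF liminf_add_ennreal] liminf_add_ennreal])
  also have "\<dots> \<le> liminf ?R"
    by (intro Liminf_mono always_eventually allI LR)
  also have "\<dots> \<le> kappa m \<phi> W f v + energy b v' + (energy b v + energy b v)"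
    unfolding R_lim split[of v] R_def[symmetric]
  proof (intro add_right_mono ennreal_leI sum_mono)
    fix x
    \<comment> \<open>As \<open>f \<ge> 0\<close>, replacing a negative value of \<open>v\<close> by
      \<open>0\<close> moves the argument towards \<open>0\<close> without crossing it.\<close>
    have "Phi \<phi> (f x - W x * v' x) \<le> Phi \<phi> (f x - W x * v x)"
    proof (cases "0 \<le> v x")
      case False
      hence "W x * v x \<le> 0" using W_pos[of x] by (simp add: mult_le_0_iff)
      thus ?thesis using False f(2)[of x] by (intro Phi_mono_abs) (auto simp: v'_def)
    qed (simp add: v'_def)
    thus "pot f v' x \<le> pot f v x"
      using m_pos[of x] W_pos[of x] unfolding pot_def by (intro mult_right_mono) auto
  qed
  \<comment> \<open>One copy of \<open>energy b v\<close> joins the potential to form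
    \<open>E f v\<close>; the remaining energies are finite and cancel.\<close>
  finally have "(energy b v' + energy b v) + c \<le> (energy b v' + energy b v) + E f v"
    by (simp add: resolvent_energy_def ac_simps)
  thus ?thesis using Qv Qv' by (auto simp: ennreal_add_left_cancel_le)
qed

lemma energy_midpoint_le:
  "energy b (\<lambda>x. (u x + v x) / 2) + energy b (\<lambda>x. (u x + v x) / 2) \<le> energy b u + energy b v"
proof (rule energy_pair_le)
  fix p :: "'a \<times> 'a"
  obtain x y where p: "p = (x, y)" by (cases p)
  define r s where "r = u x - u y" and "s = v x - v y"
  have "0 \<le> (r - s)\<^sup>2" by simp
  hence "((r + s) / 2)\<^sup>2 + ((r + s) / 2)\<^sup>2 \<le> r\<^sup>2 + s\<^sup>2"
    by (simp add: power2_eq_square field_simps)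
  hence "b x y / 2 * (((r + s) / 2)\<^sup>2 + ((r + s) / 2)\<^sup>2) \<le> b x y / 2 * (r\<^sup>2 + s\<^sup>2)"
    by (intro mult_left_mono) (simp_all add: b_nonneg)
  moreover have eq: "(u x + v x) / 2 - (u y + v y) / 2 = (r + s) / 2"
    by (simp add: r_def s_def field_simps)
  ultimately show "edge (\<lambda>x. (u x + v x) / 2) p + edge (\<lambda>x. (u x + v x) / 2) p \<le> edge u p + edge v p"
    unfolding p edge_def prod.case eq r_def[symmetric] s_def[symmetric] by (simp only: distrib_left times_divide_eq_left)
qed

text \<open>Gives uniqueness of minimizers: by strict midpoint convexity of \<open>Phi\<close>, a
  single vertex where \<open>u\<close> and \<open>v\<close> differ already yields a gain. Averaged
  approximating sequences keep the midpoint in the domain.\<close>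

lemma resolvent_dom_midpoint:
  assumes u: "u \<in> resolvent_dom b m \<phi> W f" and v: "v \<in> resolvent_dom b m \<phi> W f" and ne: "u x \<noteq> v x"
  defines "z \<equiv> \<lambda>x. (u x + v x) / 2"
  shows "z \<in> resolvent_dom b m \<phi> W f" "\<exists>d>0. E f z + E f z + ennreal d \<le> E f u + E f v"
proof -
  define d where "d y = pot f u y + pot f v y - 2 * pot f z y" for y
  have z_arg: "f y - W y * z y = ((f y - W y * u y) + (f y - W y * v y)) / 2" for y
    by (simp add: z_def field_simps)
  have d_eq: "d y = (Phi \<phi> (f y - W y * u y) + Phi \<phi> (f y - W y * v y)
      - 2 * Phi \<phi> (((f y - W y * u y) + (f y - W y * v y)) / 2)) * (m y / W y)" for y
    unfolding d_def pot_def z_arg by (simp add: algebra_simps)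
  have d_pos: "0 < d y" if "u y \<noteq> v y" for y
  proof -
    have "f y - W y * u y \<noteq> f y - W y * v y" using that W_pos[of y] by simp
    from Phi_midpoint_strict[OF this] show ?thesis
      unfolding d_eq using m_pos[of y] W_pos[of y] by (intro mult_pos_pos) auto
  qed
  have d_nonneg: "0 \<le> d y" for y
  proof (cases "u y = v y")
    case True
    hence "z y = u y" by (simp add: z_def)
    thus ?thesis using True by (simp add: d_def pot_def)
  next
    case False thus ?thesis using d_pos[of y] by simp
  qed
  \<comment> \<open>The gain is written as a sum concentrated at \<open>x\<close>, so that the
    potentials can be compared vertex by vertex.\<close>
  have "(\<Sum>\<^sub>\<infinity>y. ennreal (if y = x then d x else 0)) = ennreal (d x)"
    by (subst infsum_zero_outside[of "{x}"]) auto
  hence "kappa m \<phi> W f z + kappa m \<phi> W f z + ennreal (d x)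
      = (\<Sum>\<^sub>\<infinity>y. ennreal (pot f z y) + ennreal (pot f z y) + ennreal (if y = x then d x else 0))"
    unfolding kappa_eq by (simp add: infsum_add)
  also have "\<dots> \<le> (\<Sum>\<^sub>\<infinity>y. ennreal (pot f u y) + ennreal (pot f v y))"
  proof (intro infsum_mono summable_on_ennreal_valued)
    fix y
    have "pot f z y + pot f z y + (if y = x then d x else 0) \<le> pot f u y + pot f v y"
      using d_nonneg[of y] by (auto simp: d_def)
    thus "ennreal (pot f z y) + ennreal (pot f z y) + ennreal (if y = x then d x else 0)
        \<le> ennreal (pot f u y) + ennreal (pot f v y)"
      using d_nonneg[of x] by (simp add: pot_nonneg flip: ennreal_plus)
  qed
  also have "\<dots> = kappa m \<phi> W f u + kappa m \<phi> W f v"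
    unfolding kappa_eq by (simp add: infsum_add)
  finally have kappa: "kappa m \<phi> W f z + kappa m \<phi> W f z + ennreal (d x)
      \<le> kappa m \<phi> W f u + kappa m \<phi> W f v" .
  have Q: "energy b z + energy b z \<le> energy b u + energy b v"
    unfolding z_def by (rule energy_midpoint_le)
  have "E f z + E f z + ennreal (d x)
      = (energy b z + energy b z) + (kappa m \<phi> W f z + kappa m \<phi> W f z + ennreal (d x))"
    by (simp add: resolvent_energy_def ac_simps)
  also have "\<dots> \<le> (energy b u + energy b v) + (kappa m \<phi> W f u + kappa m \<phi> W f v)"
    by (intro add_mono Q kappa)
  also have "\<dots> = E f u + E f v" by (simp add: resolvent_energy_def ac_simps)
  finally have le: "E f z + E f z + ennreal (d x) \<le> E f u + E f v" .
  show "\<exists>d>0. E f z + E f z + ennreal d \<le> E f u + E f v"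
    using le d_pos[OF ne] by blast
  have "E f u + E f v < \<infinity>" using E_finite[OF u] E_finite[OF v] by simp
  with le have "E f z + E f z + ennreal (d x) < \<infinity>" by (rule le_less_trans)
  hence Ez: "energy b z < \<infinity>" "kappa m \<phi> W f z < \<infinity>" by (auto simp: resolvent_energy_def)
  from u obtain F where F: "\<And>n. F n \<in> Cc" "\<And>x. (\<lambda>n. F n x) \<longlonglongrightarrow> u x"
    "(\<lambda>n. energy b (\<lambda>x. u x - F n x)) \<longlonglongrightarrow> 0"
    by (auto simp: resolvent_dom_def finite_energy0_def)
  from v obtain G where G: "\<And>n. G n \<in> Cc" "\<And>x. (\<lambda>n. G n x) \<longlonglongrightarrow> v x"
    "(\<lambda>n. energy b (\<lambda>x. v x - G n x)) \<longlonglongrightarrow> 0"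
    by (auto simp: resolvent_dom_def finite_energy0_def)
  define H where "H n x = (F n x + G n x) / 2" for n x
  have "H n \<in> Cc" for n
    using F(1)[of n] G(1)[of n]
    by (intro CcI[of "{x. F n x \<noteq> 0} \<union> {x. G n x \<noteq> 0}"]) (auto simp: H_def Cc_def)
  moreover have "(\<lambda>n. H n x) \<longlonglongrightarrow> z x" for x
    unfolding H_def z_def by (intro tendsto_intros F G) auto
  moreover have "(\<lambda>n. energy b (\<lambda>x. z x - H n x)) \<longlonglongrightarrow> 0"
  proof (rule tendsto_sandwich[where f = "\<lambda>_. 0"])
    show "(\<lambda>n. energy b (\<lambda>x. u x - F n x) + energy b (\<lambda>x. v x - G n x)) \<longlonglongrightarrow> 0"
      using tendsto_add[OF F(3) G(3)] by simp
    have "energy b (\<lambda>x. z x - H n x) \<le> energy b (\<lambda>x. u x - F n x) + energy b (\<lambda>x. v x - G n x)" for n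
    proof -
      have "(\<lambda>x. z x - H n x) = (\<lambda>x. ((u x - F n x) + (v x - G n x)) / 2)"
        by (auto simp: z_def H_def field_simps)
      thus ?thesis
        using energy_midpoint_le[of "\<lambda>x. u x - F n x" "\<lambda>x. v x - G n x"]
        by (metis add_increasing2 order_trans order_refl zero_le)
    qed
    thus "\<forall>\<^sub>F n in sequentially. energy b (\<lambda>x. z x - H n x)
        \<le> energy b (\<lambda>x. u x - F n x) + energy b (\<lambda>x. v x - G n x)" by simp
  qed auto
  ultimately show "z \<in> resolvent_dom b m \<phi> W f"
    using Ez by (auto simp: resolvent_dom_def finite_energy0_def finite_energy_def intro!: exI[of _ H])
qed

lemma solves_formal_dom:
  assumes "solves K f u" "finite K"
  shows "u \<in> formal_dom b"
  using assms by (intro Cc_formal_dom CcI) (auto simp: solves_def)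

text \<open>Comparison is applied on the smaller set: off \<open>K\<close>, \<open>u\<close>
  vanishes while \<open>u'\<close> is nonnegative.\<close>

lemma solves_mono:
  assumes K: "finite K" "K \<subseteq> K'" "finite K'" and u: "solves K f u" and u': "solves K' f' u'"
    and le: "\<And>x. x \<in> K \<Longrightarrow> f x \<le> f' x" and nonneg: "\<And>x. 0 \<le> u' x"
  shows "u x \<le> u' x"
  by (rule comparison[OF K(1) solves_formal_dom[OF u K(1)] solves_formal_dom[OF u' K(3)], where f = f and f' = f'])
    (use assms in \<open>auto simp: solves_def\<close>)

text \<open>Existence and uniqueness of the minimizer, which give \<open>THE\<close> its meaning,
  are obtained here. Strong minimality makes the energies decrease and controls the distance between
  approximants by the energy drop, so the monotone limit \<open>U\<close> lies in
  \<open>finite_energy0 b\<close>. It does at least as well as every function in \<open>Cc\<close>,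
  hence by \<open>lower_bound_from_Cc\<close> as every function in the domain.\<close>

lemma resolvent_limit:
  assumes f: "f \<in> Cc" "\<And>x. 0 \<le> f x"
    and K: "\<And>n. finite (K n)" "incseq K" "(\<Union>n. K n) = UNIV" "\<And>x. x \<notin> K 0 \<Longrightarrow> f x = 0"
    and u: "\<And>n. solves (K n) f (u n)" "\<And>n x. 0 \<le> u n x \<and> u n x \<le> a"
  shows "(\<lambda>n. u n x) \<longlonglongrightarrow> resolvent b m \<phi> W f x"
proof -
  have K_mono: "K n \<subseteq> K k" if "n \<le> k" for n k using K(2) that by (auto simp: incseq_def)
  have "incseq (\<lambda>n. u n x)" for x
  proof (rule incseq_SucI)
    fix n
    show "u n x \<le> u (Suc n) x"
      by (rule solves_mono[OF K(1) K_mono K(1) u(1) u(1)]) (use u(2) in auto)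
  qed
  hence "\<exists>l. (\<lambda>n. u n x) \<longlonglongrightarrow> l" for x
    using u(2) by (metis incseq_convergent)
  then obtain U where U: "\<And>x. (\<lambda>n. u n x) \<longlonglongrightarrow> U x" by metis
  have f0: "f x = 0" if "x \<notin> K n" for x n using that K(4) K_mono[of 0 n] by auto
  have u0: "u n x = 0" if "x \<notin> K n" for x n using that u(1)[of n] by (simp add: solves_def)
  have u_Cc: "u n \<in> Cc" for n by (rule CcI[OF K(1)]) (rule u0)
  define e where "e n = E f (u n)" for n
  define l where "l = (INF n. e n)"
  \<comment> \<open>As \<open>K n \<subseteq> K k\<close>, the function \<open>u n\<close> competes
    with the minimizer \<open>u k\<close>.\<close>
  have step: "e k + energy b (\<lambda>x. u n x - u k x) \<le> e n" if "n \<le> k" for n k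
    unfolding e_def using K_mono[OF that] u0
    by (intro strong_min[OF K(1) f0 u(1)]) auto
  have "decseq e"
    unfolding decseq_def using step by (meson add_increasing2 order_trans order_refl zero_le le_add_same_cancel1)
  hence e_lim: "e \<longlonglongrightarrow> l" unfolding l_def by (rule LIMSEQ_INF)
  have e_fin: "e n < \<infinity>" for n
    unfolding e_def by (rule E_finite[OF Cc_resolvent_dom[OF u_Cc f(1)]])
  have l_le: "l \<le> e n" for n unfolding l_def by (rule INF_lower) simp
  have l_fin: "l < \<infinity>" by (rule le_less_trans[OF l_le e_fin])
  have "E f U \<le> liminf e" unfolding e_def by (rule E_liminf[OF U])
  hence EU: "E f U \<le> l" using e_lim by (simp add: lim_imp_Liminf)
  \<comment> \<open>Fatou in \<open>k\<close> with \<open>n\<close> fixed turns the Cauchy estimate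
    into one for the limit.\<close>
  have QU: "energy b (\<lambda>x. U x - u n x) \<le> e n - l" for n
  proof (rule le_liminf_trans)
    show "energy b (\<lambda>x. U x - u n x) \<le> liminf (\<lambda>k. energy b (\<lambda>x. u k x - u n x))"
      by (intro energy_liminf tendsto_intros U)
    show "\<forall>\<^sub>F k in sequentially. energy b (\<lambda>x. u k x - u n x) \<le> e n - l"
    proof (rule eventually_sequentiallyI[of n])
      fix k assume "n \<le> k"
      have "l + energy b (\<lambda>x. u n x - u k x) \<le> e n"
        by (rule order_trans[OF add_right_mono[OF l_le] step[OF \<open>n \<le> k\<close>]])
      thus "energy b (\<lambda>x. u k x - u n x) \<le> e n - l"
        using l_fin by (subst energy_diff_commute) (simp add: ennreal_le_minus_iff add.commute)
    qed
  qed
  have "(\<lambda>n. energy b (\<lambda>x. U x - u n x)) \<longlonglongrightarrow> 0"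
  proof (rule tendsto_sandwich[where f = "\<lambda>_. 0"])
    have "(\<lambda>n. e n - l) \<longlonglongrightarrow> l - l"
      using l_fin by (intro tendsto_diff_ennreal_general e_lim tendsto_const) auto
    thus "(\<lambda>n. e n - l) \<longlonglongrightarrow> 0" using l_fin by simp
    show "\<forall>\<^sub>F n in sequentially. energy b (\<lambda>x. U x - u n x) \<le> e n - l" using QU by simp
  qed auto
  hence U_dom: "U \<in> resolvent_dom b m \<phi> W f"
    using le_less_trans[OF EU l_fin] U u_Cc
    unfolding resolvent_dom_def finite_energy0_def finite_energy_def resolvent_energy_def by auto
  have "E f U \<le> E f w" if w: "w \<in> Cc" for w
  proof -
    have "finite {x. w x \<noteq> 0}" using w by (simp add: Cc_def)
    then obtain N where N: "{x. w x \<noteq> 0} \<subseteq> K N"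
      using exhaustion_contains_finite[OF K(2,3)] by blast
    have "e N + energy b (\<lambda>x. w x - u N x) \<le> E f w"
      unfolding e_def using N by (intro strong_min[OF K(1) f0 u(1)]) auto
    hence "e N \<le> E f w" by (meson add_increasing2 order_trans order_refl zero_le)
    thus ?thesis using EU l_le[of N] by (meson order_trans)
  qed
  hence U_min: "E f U \<le> E f v" if "v \<in> resolvent_dom b m \<phi> W f" for v
    using lower_bound_from_Cc[OF f that] by blast
  have "resolvent b m \<phi> W f = U"
    unfolding resolvent_def
  proof (rule the_equality)
    fix V assume V: "V \<in> resolvent_dom b m \<phi> W f \<and> (\<forall>v\<in>resolvent_dom b m \<phi> W f. E f V \<le> E f v)"
    show "V = U"
    proof (rule ccontr)
      assume "V \<noteq> U"
      then obtain x where x: "V x \<noteq> U x" by blast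
      define z where "z x = (V x + U x) / 2" for x
      obtain d where z: "z \<in> resolvent_dom b m \<phi> W f"
        and d: "0 < d" "E f z + E f z + ennreal d \<le> E f V + E f U"
        using resolvent_dom_midpoint[OF conjunct1[OF V] U_dom, OF x] unfolding z_def[symmetric] by blast
      \<comment> \<open>Neither minimizer has more energy than \<open>z\<close>, so the gain
        \<open>d\<close> would have to vanish.\<close>
      have "(E f V + E f U) + ennreal d \<le> (E f z + E f z) + ennreal d"
        using V U_min z by (intro add_right_mono add_mono) auto
      also have "\<dots> \<le> (E f V + E f U) + 0" using d(2) by simp
      finally have "(E f V + E f U) + ennreal d \<le> (E f V + E f U) + 0" .
      moreover have "E f V + E f U < \<infinity>" using E_finite V U_dom by simp
      ultimately show False using d(1) by (auto simp: ennreal_add_left_cancel_le)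
    qed
  qed (use U_dom U_min in blast)
  thus ?thesis using U by simp
qed

text \<open>Along an exhaustion starting at \<open>K\<close>, the solutions dominate
  \<open>u\<close> and converge to the resolvent.\<close>

lemma solves_le_resolvent:
  assumes f: "\<And>x. 0 \<le> f x" "\<And>x. f x \<le> a * W x"
    and K: "finite K" "\<And>x. x \<notin> K \<Longrightarrow> f x = 0" and u: "solves K f u"
  shows "u x \<le> resolvent b m \<phi> W f x"
proof -
  have fC: "f \<in> Cc" by (rule CcI[OF K])
  obtain A where A: "\<And>n. finite (A n)" "incseq A" "(\<Union>n. A n) = UNIV" "A 0 = K"
    using countable_exhaustion[OF K(1)] by blast
  have "\<exists>w. solves (A n) f w \<and> (\<forall>x. 0 \<le> w x \<and> w x \<le> a)" for n
    using solves_exists[of f a "A n"] f by metis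
  then obtain w where w: "\<And>n. solves (A n) f (w n)" "\<And>n x. 0 \<le> w n x \<and> w n x \<le> a" by metis
  have "(\<lambda>n. w n x) \<longlonglongrightarrow> resolvent b m \<phi> W f x"
    by (rule resolvent_limit[OF fC f(1) A(1-3) _ w]) (use A(4) K(2) in auto)
  moreover have "u x \<le> w n x" for n
    using A(2,4) w(2) by (intro solves_mono[OF K(1) _ A(1) u w(1)]) (auto simp: incseq_def)
  ultimately show ?thesis by (intro LIMSEQ_le_const) auto
qed

text \<open>As \<open>f \<le> a * W\<close>, a supersolution for the larger datum dominates the
  solution on each finite set, and the bound survives the limit.\<close>

lemma resolvent_le_supersolution:
  assumes f: "f \<in> Cc" "\<And>x. 0 \<le> f x" "\<And>x. f x \<le> a * W x"
    and h: "h \<in> formal_dom b" "\<And>x. 0 \<le> h x" "\<And>x. \<phi> (a * W x - W x * h x) \<le> Lap b m h x"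
  shows "resolvent b m \<phi> W f x \<le> h x"
proof -
  have "finite {x. f x \<noteq> 0}" using f by (simp add: Cc_def)
  then obtain A where A: "\<And>n. finite (A n)" "incseq A" "(\<Union>n. A n) = UNIV" "A 0 = {x. f x \<noteq> 0}"
    using countable_exhaustion by blast
  have "\<exists>w. solves (A n) f w \<and> (\<forall>x. 0 \<le> w x \<and> w x \<le> a)" for n
    using solves_exists[of f a "A n"] f by metis
  then obtain w where w: "\<And>n. solves (A n) f (w n)" "\<And>n x. 0 \<le> w n x \<and> w n x \<le> a" by metis
  have "(\<lambda>n. w n x) \<longlonglongrightarrow> resolvent b m \<phi> W f x"
    by (rule resolvent_limit[OF f(1,2) A(1-3) _ w]) (use A(4) in auto)
  moreover have "w n x \<le> h x" for n
    by (rule comparison[OF A(1)[of n] solves_formal_dom[OF w(1) A(1)] h(1), where f = f and f' = "\<lambda>x. a * W x"])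
      (use w(1)[of n] h f(3) in \<open>auto simp: solves_def\<close>)
  ultimately show ?thesis by (intro LIMSEQ_le_const2) auto
qed

subsection \<open>The extended resolvent of multiples of \<open>W\<close>\<close>

lemma Lap_const: "Lap b m (\<lambda>_. c) x = 0"
  by (simp add: Lap_def)

lemma ext_resolvent_le:
  assumes "h \<in> formal_dom b" "\<And>x. 0 \<le> h x" "\<And>x. \<phi> (a * W x - W x * h x) \<le> Lap b m h x"
  shows "ext_resolvent b m \<phi> W (\<lambda>y. a * W y) x \<le> ereal (h x)"
  unfolding ext_resolvent_def
proof (rule SUP_least)
  fix g assume "g \<in> {g \<in> Cc. \<forall>y. 0 \<le> g y \<and> g y \<le> a * W y}"
  thus "ereal (resolvent b m \<phi> W g x) \<le> ereal (h x)"
    using resolvent_le_supersolution[OF _ _ _ assms] by simp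
qed

text \<open>Cutting \<open>a * W\<close> off outside \<open>A n\<close> makes it admissible in the
  supremum defining \<open>ext_resolvent\<close>. The solutions increase because the sets and the
  data do, and the equation passes to their limit.\<close>

lemma solution_below_ext_resolvent:
  assumes "0 \<le> a"
  obtains w where "\<And>x. 0 \<le> w x \<and> w x \<le> a" "\<And>x. Lap b m w x = \<phi> (a * W x - W x * w x)"
    "\<And>x. ereal (w x) \<le> ext_resolvent b m \<phi> W (\<lambda>y. a * W y) x"
proof -
  obtain A :: "nat \<Rightarrow> 'a set" where A: "\<And>n. finite (A n)" "incseq A" "(\<Union>n. A n) = UNIV" "A 0 = {}"
    using countable_exhaustion[of "{}"] by blast
  have A_mono: "A n \<subseteq> A k" if "n \<le> k" for n k using A(2) that by (auto simp: incseq_def)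
  define f where "f n x = (if x \<in> A n then a * W x else 0)" for n x
  have f: "0 \<le> f n x" "f n x \<le> a * W x" for n x
    using assms W_pos[of x] by (auto simp: f_def)
  have "\<exists>w. solves (A n) (f n) w \<and> (\<forall>x. 0 \<le> w x \<and> w x \<le> a)" for n
    using solves_exists[of "f n" a "A n"] f by metis
  then obtain u where u: "\<And>n. solves (A n) (f n) (u n)" "\<And>n x. 0 \<le> u n x \<and> u n x \<le> a" by metis
  have inc: "incseq (\<lambda>n. u n x)" for x
  proof (rule incseq_SucI)
    fix n
    show "u n x \<le> u (Suc n) x"
      by (rule solves_mono[OF A(1) A_mono A(1) u(1) u(1)])
        (use u(2) A_mono[of n "Suc n"] in \<open>auto simp: f_def\<close>)
  qed
  hence "\<exists>l. (\<lambda>n. u n x) \<longlonglongrightarrow> l" for x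
    using u(2) by (metis incseq_convergent)
  then obtain w where w: "\<And>x. (\<lambda>n. u n x) \<longlonglongrightarrow> w x" by metis
  have u_le: "u n x \<le> w x" for n x by (rule incseq_le[OF inc w])
  have w_bd: "0 \<le> w x \<and> w x \<le> a" for x
    using u(2) by (auto intro!: LIMSEQ_le_const[OF w] LIMSEQ_le_const2[OF w])
  have w_dom: "w \<in> formal_dom b" by (rule bdd_formal_dom[OF w_bd])
  have u_dom: "u n \<in> formal_dom b" for n by (rule solves_formal_dom[OF u(1) A(1)])
  have "Lap b m w x = \<phi> (a * W x - W x * w x)" for x
  proof -
    \<comment> \<open>From index \<open>N\<close> on the cutoff is invisible at
      \<open>x\<close>.\<close>
    obtain N where "x \<in> A N" using A(3) by blast
    hence xA: "x \<in> A n" if "N \<le> n" for n using A_mono[OF that] by blast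
    \<comment> \<open>\<open>r n\<close> is the neighbour sum expressed through the equation at
      \<open>x\<close>; it depends continuously on \<open>u n x\<close> alone.\<close>
    define r where "r n = deg x * u n x - m x * \<phi> (a * W x - W x * u n x)" for n
    define r' where "r' = deg x * w x - m x * \<phi> (a * W x - W x * w x)"
    have phi_cont': "isCont \<phi> t" for t using phi_cont by (simp add: continuous_on_eq_continuous_at)
    have r_lim: "r \<longlonglongrightarrow> r'"
      unfolding r_def r'_def by (intro tendsto_intros isCont_tendsto_compose[OF phi_cont'] w)
    have r_eq: "(\<Sum>\<^sub>\<infinity>y. b x y * u n y) = r n" if "N \<le> n" for n
    proof -
      have "Lap b m (u n) x = \<phi> (a * W x - W x * u n x)"
        using u(1)[of n] xA[OF that] by (simp add: solves_def f_def)
      thus ?thesis unfolding Lap_eq_iff[OF u_dom] r_def by simp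
    qed
    \<comment> \<open>Monotone convergence in two halves: finite partial sums of the limit are
      bounded by \<open>r'\<close>, and conversely \<open>u n \<le> w\<close> bounds each
      \<open>r n\<close>.\<close>
    have "(\<Sum>\<^sub>\<infinity>y. b x y * w y) \<le> r'"
    proof (rule infsum_le_finite_sums[OF summable_nbh[OF w_dom]])
      fix F :: "'a set" assume F: "finite F"
      have "(\<lambda>n. \<Sum>y\<in>F. b x y * u n y) \<longlonglongrightarrow> (\<Sum>y\<in>F. b x y * w y)"
        by (intro tendsto_intros w)
      moreover have "(\<Sum>y\<in>F. b x y * u n y) \<le> r n" if "N \<le> n" for n
        unfolding r_eq[OF that, symmetric]
        using F u(2) by (intro finite_sum_le_infsum summable_nbh u_dom) (auto simp: b_nonneg)
      ultimately show "(\<Sum>y\<in>F. b x y * w y) \<le> r'" by (intro LIMSEQ_le[OF _ r_lim]) blast+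
    qed
    moreover have "r' \<le> (\<Sum>\<^sub>\<infinity>y. b x y * w y)"
    proof (rule LIMSEQ_le_const2[OF r_lim], intro exI allI impI)
      fix n assume "N \<le> n"
      show "r n \<le> (\<Sum>\<^sub>\<infinity>y. b x y * w y)"
        unfolding r_eq[OF \<open>N \<le> n\<close>, symmetric] by (intro nbh_mono u_dom w_dom u_le)
    qed
    ultimately show ?thesis unfolding Lap_eq_iff[OF w_dom] r'_def by linarith
  qed
  moreover have "ereal (w x) \<le> ext_resolvent b m \<phi> W (\<lambda>y. a * W y) x" for x
  proof (rule LIMSEQ_le_const2)
    show "(\<lambda>n. ereal (u n x)) \<longlonglongrightarrow> ereal (w x)" using w[of x] by simp
    have "ereal (u n x) \<le> ext_resolvent b m \<phi> W (\<lambda>y. a * W y) x" for n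
    proof -
      have "f n \<in> Cc" by (rule CcI[OF A(1)[of n]]) (simp add: f_def)
      have "u n x \<le> resolvent b m \<phi> W (f n) x"
        by (rule solves_le_resolvent[OF f A(1) _ u(1)]) (simp add: f_def)
      hence "ereal (u n x) \<le> ereal (resolvent b m \<phi> W (f n) x)" by simp
      also have "\<dots> \<le> ext_resolvent b m \<phi> W (\<lambda>y. a * W y) x"
        unfolding ext_resolvent_def
        using f \<open>f n \<in> Cc\<close> by (intro SUP_upper) simp
      finally show ?thesis .
    qed
    thus "\<exists>N. \<forall>n\<ge>N. ereal (u n x) \<le> ext_resolvent b m \<phi> W (\<lambda>y. a * W y) x" by blast
  qed
  ultimately show ?thesis using w_bd that by blast
qed

section \<open>Passing between the five assertions\<close>

lemma inv_phi [simp]: "inv \<phi> (\<phi> t) = t"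
  by (rule inv_f_f[OF strict_mono_imp_inj_on[OF phi_mono]])

lemma phi_inv: "g \<in> formal_dom_phi b m \<phi> \<Longrightarrow> \<phi> (inv \<phi> (Lap b m g x)) = Lap b m g x"
  by (auto simp: formal_dom_phi_def f_inv_into_f)

lemma linfty_formal_dom:
  assumes "f \<in> linfty"
  shows "f \<in> formal_dom b"
proof -
  obtain c where "\<And>x. \<bar>f x\<bar> \<le> c" using assms by (auto simp: linfty_def bounded_iff)
  thus ?thesis by (rule formal_dom_bounded)
qed

lemma linftyI: "(\<And>x. \<bar>f x\<bar> \<le> c) \<Longrightarrow> f \<in> linfty"
  by (auto simp: linfty_def bounded_iff)

lemma Lap_uminus: "Lap b m (\<lambda>x. - f x) x = - Lap b m f x"
proof -
  have "(\<Sum>\<^sub>\<infinity>y. b x y * (- f x - - f y)) = (\<Sum>\<^sub>\<infinity>y. - (b x y * (f x - f y)))"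
    by (simp add: algebra_simps)
  thus ?thesis unfolding Lap_def infsum_uminus by simp
qed

text \<open>Assertion (i).\<close>

definition const_resolvent :: bool where
  "const_resolvent \<longleftrightarrow> (\<forall>\<alpha>::real. 0 \<le> \<alpha> \<longrightarrow>
    (\<forall>x. ext_resolvent b m \<phi> W (\<lambda>y. \<alpha> * W y) x = ereal \<alpha>))"

text \<open>Assertion (ii).\<close>

definition no_nonpos_solution :: bool where
  "no_nonpos_solution \<longleftrightarrow> (\<forall>g \<in> linfty \<inter> formal_dom_phi b m \<phi>.
    (\<forall>x. g x \<le> 0) \<and> (\<forall>x. inv \<phi> (Lap b m g x) + W x * g x = 0) \<longrightarrow> (\<forall>x. g x = 0))"

lemma const_resolvent_if:
  assumes no_nonpos_solution
  shows const_resolvent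
  unfolding const_resolvent_def
proof (intro allI impI antisym)
  fix \<alpha> :: real and x assume a: "0 \<le> \<alpha>"
  \<comment> \<open>The constant \<open>\<alpha>\<close> is itself a supersolution: its Laplacian is
    \<open>0 = \<phi> 0\<close>.\<close>
  show "ext_resolvent b m \<phi> W (\<lambda>y. \<alpha> * W y) x \<le> ereal \<alpha>"
    using ext_resolvent_le[of "\<lambda>_. \<alpha>" \<alpha> x] a formal_dom_bounded[of "\<lambda>_. \<alpha>" \<alpha>]
    by (simp add: Lap_const mult.commute phi_zero)
  obtain w where w: "\<And>x. 0 \<le> w x \<and> w x \<le> \<alpha>" "\<And>x. Lap b m w x = \<phi> (\<alpha> * W x - W x * w x)"
    "\<And>x. ereal (w x) \<le> ext_resolvent b m \<phi> W (\<lambda>y. \<alpha> * W y) x"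
    using solution_below_ext_resolvent[OF a] by blast
  \<comment> \<open>Translation keeps the Laplacian, so the equation for \<open>w\<close> becomes
    \<open>inv \<phi> (Lap b m g x) = - (W x * g x)\<close>.\<close>
  define g where "g x = w x + - \<alpha>" for x
  have Lg: "Lap b m g = Lap b m w" unfolding g_def[abs_def] by (rule Lap_add_const)
  have "g \<in> linfty" using w(1) by (intro linftyI[of _ \<alpha>]) (auto simp: g_def abs_le_iff)
  moreover from this have "g \<in> formal_dom_phi b m \<phi>"
    by (simp add: formal_dom_phi_def linfty_formal_dom Lg w(2))
  moreover have "g x \<le> 0" "inv \<phi> (Lap b m g x) + W x * g x = 0" for x
    using w(1)[of x] by (auto simp: Lg w(2) g_def algebra_simps)
  ultimately have "g x = 0" using assms unfolding no_nonpos_solution_def by blast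
  thus "ereal \<alpha> \<le> ext_resolvent b m \<phi> W (\<lambda>y. \<alpha> * W y) x" using w(3)[of x] by (simp add: g_def)
qed

lemma supersolution_nonneg:
  assumes const_resolvent and g: "g \<in> linfty \<inter> formal_dom_phi b m \<phi>"
    and super: "\<And>x. 0 \<le> inv \<phi> (Lap b m g x) + W x * g x"
  shows "0 \<le> g x"
proof -
  obtain a where a: "\<And>x. \<bar>g x\<bar> \<le> a" using g by (auto simp: linfty_def bounded_iff)
  have "0 \<le> a" using a[of x] by simp
  define h where "h x = g x + a" for x
  have Lh: "Lap b m h = Lap b m g" unfolding h_def[abs_def] by (rule Lap_add_const)
  have "ext_resolvent b m \<phi> W (\<lambda>y. a * W y) x \<le> ereal (h x)"
  proof (rule ext_resolvent_le)
    show "h \<in> formal_dom b"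
      unfolding h_def[abs_def] using g by (intro formal_dom_add_const) (simp add: formal_dom_phi_def)
    show "0 \<le> h x" for x using a[of x] by (simp add: h_def)
    show "\<phi> (a * W x - W x * h x) \<le> Lap b m h x" for x
    proof -
      \<comment> \<open>The argument on the left is \<open>- (W x * g x)\<close>, so the assumption
        on \<open>g\<close> says that \<open>h\<close> is a supersolution for the datum
        \<open>a * W\<close>.\<close>
      have "\<phi> (a * W x - W x * h x) \<le> \<phi> (inv \<phi> (Lap b m g x))"
        using super[of x] by (simp add: phi_le_iff h_def algebra_simps)
      thus ?thesis using g by (simp add: Lh phi_inv)
    qed
  qed
  thus ?thesis using assms(1) \<open>0 \<le> a\<close> unfolding const_resolvent_def by (simp add: h_def)
qed

text \<open>Assertion (v) is (ii) for \<open>f = - g\<close>. That \<open>- f\<close> belongs to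
  \<open>formal_dom_phi b m \<phi>\<close> follows from the equation in (v), which displays its
  Laplacian as a value of \<open>\<phi>\<close>.\<close>

lemma no_nonpos_solution_iff:
  "no_nonpos_solution \<longleftrightarrow>
    (\<forall>f \<in> linfty. (\<forall>x. f x \<ge> 0) \<and> (\<forall>x. - Lap b m f x = \<phi> (W x * f x)) \<longrightarrow> (\<forall>x. f x = 0))"
    (is "_ \<longleftrightarrow> ?v")
proof
  have neg: "(\<lambda>x. - f x) \<in> linfty" if "f \<in> linfty" for f :: "'a \<Rightarrow> real"
    using that by (simp add: linfty_def bounded_iff)
  assume ii: no_nonpos_solution
  show ?v
  proof (intro ballI impI)
    fix f :: "'a \<Rightarrow> real" assume f: "f \<in> linfty" and *: "(\<forall>x. f x \<ge> 0) \<and> (\<forall>x. - Lap b m f x = \<phi> (W x * f x))"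
    have L: "Lap b m (\<lambda>x. - f x) x = \<phi> (W x * f x)" for x using * by (simp add: Lap_uminus)
    have "(\<lambda>x. - f x) \<in> linfty \<inter> formal_dom_phi b m \<phi>"
      using neg[OF f] by (simp add: formal_dom_phi_def linfty_formal_dom L)
    from bspec[OF ii[unfolded no_nonpos_solution_def] this] show "\<forall>x. f x = 0"
      using * by (simp add: L)
  qed
next
  have neg: "(\<lambda>x. - f x) \<in> linfty" if "f \<in> linfty" for f :: "'a \<Rightarrow> real"
    using that by (simp add: linfty_def bounded_iff)
  assume v: ?v
  show no_nonpos_solution
    unfolding no_nonpos_solution_def
  proof (intro ballI impI)
    fix g assume g: "g \<in> linfty \<inter> formal_dom_phi b m \<phi>"
      and *: "(\<forall>x. g x \<le> 0) \<and> (\<forall>x. inv \<phi> (Lap b m g x) + W x * g x = 0)"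
    have "Lap b m g x = \<phi> (- (W x * g x))" for x
    proof -
      have "inv \<phi> (Lap b m g x) = - (W x * g x)" using * by (simp add: eq_neg_iff_add_eq_0)
      thus ?thesis using phi_inv[of g x] g by simp
    qed
    thus "\<forall>x. g x = 0" using bspec[OF v neg[of g]] g * by (simp add: Lap_uminus)
  qed
qed

end

theorem theorem4p2:
  fixes b :: "'a::countable \<Rightarrow> 'a \<Rightarrow> real"
    and m W :: "'a \<Rightarrow> real"
    and \<phi> :: "real \<Rightarrow> real"
  assumes "weighted_graph b"
    and "\<forall>x. 0 < m x"
    and "continuous_on UNIV \<phi>" and "strict_mono \<phi>" and "\<phi> 0 = 0"
    and "\<forall>x. 0 < W x" and "0 < (INF x. W x)"
  shows
    "let
       i = (\<forall>\<alpha>::real. 0 \<le> \<alpha> \<longrightarrow>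
              (\<forall>x. ext_resolvent b m \<phi> W (\<lambda>y. \<alpha> * W y) x = ereal \<alpha>));
       ii = (\<forall>g \<in> linfty \<inter> formal_dom_phi b m \<phi>.
              (\<forall>x. g x \<le> 0) \<and> (\<forall>x. inv \<phi> (Lap b m g x) + W x * g x = 0) \<longrightarrow>
              (\<forall>x. g x = 0));
       iii = (\<forall>g \<in> linfty \<inter> formal_dom_phi b m \<phi>.
              (\<forall>x. g x \<le> 0) \<and> (\<forall>x. inv \<phi> (Lap b m g x) + W x * g x \<ge> 0) \<longrightarrow>
              (\<forall>x. g x = 0));
       iv = (\<forall>g \<in> linfty \<inter> formal_dom_phi b m \<phi>.
              (\<forall>x. inv \<phi> (Lap b m g x) + W x * g x \<ge> 0) \<longrightarrow>
              (\<forall>x. g x \<ge> 0));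
       v = (\<forall>f \<in> linfty.
              (\<forall>x. f x \<ge> 0) \<and> (\<forall>x. - Lap b m f x = \<phi> (W x * f x)) \<longrightarrow>
              (\<forall>x. f x = 0))
     in (i \<longleftrightarrow> ii) \<and> (ii \<longleftrightarrow> iii) \<and> (iii \<longleftrightarrow> iv) \<and> (iv \<longleftrightarrow> v)"
proof -
  interpret nonlinear_graph b m W \<phi>
    using assms by unfold_locales auto
  define iii where "iii \<longleftrightarrow> (\<forall>g \<in> linfty \<inter> formal_dom_phi b m \<phi>.
    (\<forall>x. g x \<le> 0) \<and> (\<forall>x. inv \<phi> (Lap b m g x) + W x * g x \<ge> 0) \<longrightarrow> (\<forall>x. g x = 0))"
  define iv where "iv \<longleftrightarrow> (\<forall>g \<in> linfty \<inter> formal_dom_phi b m \<phi>.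
    (\<forall>x. inv \<phi> (Lap b m g x) + W x * g x \<ge> 0) \<longrightarrow> (\<forall>x. g x \<ge> 0))"
  \<comment> \<open>The implications run in the cycle (ii), (i), (iv), (iii), (ii); (v) is attached
    to (ii) by \<open>no_nonpos_solution_iff\<close>.\<close>
  have 1: "no_nonpos_solution \<Longrightarrow> const_resolvent" by (rule const_resolvent_if)
  have 2: "const_resolvent \<Longrightarrow> iv" using supersolution_nonneg unfolding iv_def by blast
  have 3: "iv \<Longrightarrow> iii" unfolding iv_def iii_def by (meson antisym)
  have 4: "iii \<Longrightarrow> no_nonpos_solution" unfolding iii_def no_nonpos_solution_def by (metis order_refl)
  show ?thesis
    unfolding Let_def const_resolvent_def[symmetric] no_nonpos_solution_def[symmetric]
      no_nonpos_solution_iff[symmetric] iii_def[symmetric] iv_def[symmetric]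
    using 1 2 3 4 by blast
qed

end
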